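(* Let $(X^{(a)}(t))_{t\ge 0}$, $a\in\ell\setminus\{0\}$, be a family of irreducible discrete time birth and death chains on rooted trees $I_a$, indexed by the non-root vertices $a$ of an infinite path $\ell$ starting at the root, and suppose the family satisfies the $0^{\ell}$-SD condition (strong drift toward $0$ along the path $\ell$). Then $$\lim_{a\to\infty}\operatorname{Var}\left(\frac{T^{(a)}_{a\to 0}}{\mathbb{E}\left[T^{(a)}_{a\to 0}\right]}\right)=0 .$$ As a consequence, the random variables $T^{(a)}_{a\to 0}$ exhibit cut-off behavior at mean times as $a\to\infty$.
   Context: Tree notation. A tree is a connected undirected graph without cycles; one vertex, denoted $0$, is chosen as root. For a tree with vertex set $I$, put $J=I\setminus\{0\}$. Write $x\preceq y$ if $x$ lies on the path from $y$ to $0$ (including $x=y$). Each $x\in J$ has a unique parent $p(x)$ (the neighbor of $x$ with $p(x)\preceq x$). $d(x)$ is the length of the path from $x$ to $0$; $\ell(x)=\{x_0,x_1,\dots,x_{d(x)-1}\}$ with $x_i=p^i(x)$ is the set of vertices on that path except $0$; $\alpha(x)=x_{d(x)-1}$ is the last vertex before $0$ on that path. $\sigma(x)=\{y: p(y)=x\}$ is the set of children of $x$ and $B_x=\{y: x\preceq y\}$ is the branch stemming from $x$. Chains. A birth and death chain on $I$ is a Markov chain $X(t)$, $t=0,1,2,\dots$, with transition probabilities $\lambda_x=P(p(x),x)>0$ and $\mu_x=P(x,p(x))>0$ for $x\in J$, and possibly waiting probabilities $\kappa_x=P(x,x)\ge 0$ for $x\in I$, all other transition probabilities being $0$; thus $\mu_x+\kappa_x+\sum_{y\in\sigma(x)}\lambda_y=1$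 for $x\in J$ and $\kappa_0+\sum_{x\in\sigma(0)}\lambda_x=1$. If $I$ is infinite, it is assumed that $\sum_{x\in I}\prod_{y\in\ell(x)}\lambda_y/\mu_y<\infty$. The chain is then positive recurrent with unique (reversible) invariant probability measure $\pi(x)=\pi(0)\prod_{y\in\ell(x)}\lambda_y/\mu_y$. Hitting times: $T_{x\to y}=\min\{t\ge 0: X^x(t)=y\}$, where $X^x$ is the chain started at $x$. Families. $\ell$ is an infinite path $0=v_0,v_1,v_2,\dots$. For each $a=v_n$ with $n\ge 1$, $I_a$ is a tree rooted at $0$ containing the vertices $v_0,\dots,v_n$ with $p(v_k)=v_{k-1}$ for $1\le k\le n$ (so $d(a)=n$ and $\ell(a)=\{v_1,\dots,v_n\}$), and $X^{(a)}$ is a birth and death chain on $I_a$, that is, a Markov chain on $I_a$ with transition probabilities $\lambda^{(a)}_x=P^{(a)}(p(x),x)>0$ and $\mu^{(a)}_x=P^{(a)}(x,p(x))>0$ for $x\in I_a\setminus\{0\}$, possibly waiting probabilities $\kappa^{(a)}_x=P^{(a)}(x,x)\ge 0$ for $x\in I_a$, and all other transition probabilities equal to $0$, satisfying $\sum_{x\in I_a}\prod_{y\in\ell(x)}\lambda^{(a)}_y/\mu^{(a)}_y<\infty$ if $I_a$ is infinite. Quantities of $X^{(a)}$ carry the superscript $(a)$; branches are taken in $I_a$. The transition probabilities may depend on $a$. "$a\to\infty$" means $a\in\ell$ and $d(a)\to\infty$. $0^\ell$-SD condition. (i) There is a constant $K_\mu>0$ such that $\inf_{b\in B_{\alpha(a)}}\mu^{(a)}_b\ge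 K_\mu$ for all $a\in\ell\setminus\{0\}$; (ii) the quantity $K_a=\sup_{b\in B_{\alpha(a)}}\mu^{(a)}_b\,\mathbb{E}[T^{(a)}_{b\to p(b)}]$ satisfies $K_a^2/\mathbb{E}[T^{(a)}_{a\to 0}]\to 0$ as $a\to\infty$. (Equivalently $K_a=\sup_{b\in B_{\alpha(a)}}\pi^{(a)}(B_b)/\pi^{(a)}(b)$.) Cut-off. A family of random variables $U^{(a)}$ exhibits cut-off behavior at mean times if $U^{(a)}/\mathbb{E}[U^{(a)}]\to 1$ in probability as $a\to\infty$. *)

theory Defs
  imports
    "HOL-Probability.Probability"
    "Graph_Theory.Digraph_Component"
    "Graph_Theory.Vertex_Walk"
begin

section \<open>Rooted trees\<close>

text \<open>
  An undirected graph is a symmetric loop-free digraph without parallel arcs. For such a graph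
  the closed walk \<open>x, y, x\<close> along a single edge counts as a \<^const>\<open>pre_digraph.cycle\<close>;
  the cycles of the undirected graph are exactly the cycles of length at least 3. (This is why
  \<open>Digraph_Component.tree\<close>, which is about one orientation of each edge, is not used.)
  Vertex sets may be infinite.
\<close>

definition undirected_tree :: "'v pair_pre_digraph \<Rightarrow> bool" where
  "undirected_tree G \<longleftrightarrow>
     pair_bidirected_digraph G \<and>
     Digraph_Component.connected (with_proj G) \<and>
     \<not> (\<exists>c. pre_digraph.cycle (with_proj G) c \<and> 3 \<le> length c)"

definition rooted_tree :: "'v pair_pre_digraph \<Rightarrow> 'v \<Rightarrow> bool" where
  "rooted_tree G r \<longleftrightarrow> undirected_tree G \<and> r \<in> pverts G"

text \<open>The vertices of the path from \<open>x\<close> to the root \<open>r\<close>, in this order and including both ends.\<close>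

definition root_path :: "'v pair_pre_digraph \<Rightarrow> 'v \<Rightarrow> 'v \<Rightarrow> 'v list" where
  "root_path G r x = (THE xs. vpath xs (with_proj G) \<and> hd xs = x \<and> last xs = r)"

definition tree_le :: "'v pair_pre_digraph \<Rightarrow> 'v \<Rightarrow> 'v \<Rightarrow> 'v \<Rightarrow> bool" where
  "tree_le G r x y \<longleftrightarrow> x \<in> set (root_path G r y)"

definition parent :: "'v pair_pre_digraph \<Rightarrow> 'v \<Rightarrow> 'v \<Rightarrow> 'v" where
  "parent G r x = (THE y. (x, y) \<in> parcs G \<and> tree_le G r y x)"

definition depth :: "'v pair_pre_digraph \<Rightarrow> 'v \<Rightarrow> 'v \<Rightarrow> nat" where
  "depth G r x = vwalk_length (root_path G r x)"

definition nonroot_path :: "'v pair_pre_digraph \<Rightarrow> 'v \<Rightarrow> 'v \<Rightarrow> 'v set" where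
  "nonroot_path G r x = (\<lambda>i. (parent G r ^^ i) x) ` {..<depth G r x}"

definition top_vertex :: "'v pair_pre_digraph \<Rightarrow> 'v \<Rightarrow> 'v \<Rightarrow> 'v" where
  "top_vertex G r x = (parent G r ^^ (depth G r x - 1)) x"

definition branch :: "'v pair_pre_digraph \<Rightarrow> 'v \<Rightarrow> 'v \<Rightarrow> 'v set" where
  "branch G r x = {y \<in> pverts G. tree_le G r x y}"


section \<open>Birth and death chains\<close>

text \<open>
  With \<open>p = parent G r\<close>, the quantities \<open>\<lambda>\<^sub>x\<close>, \<open>\<mu>\<^sub>x\<close>, \<open>\<kappa>\<^sub>x\<close> are \<open>P (p x) x\<close>, \<open>P x (p x)\<close>, \<open>P x x\<close>. As all
  other entries vanish, the row sum condition is \<open>\<mu>\<^sub>x + \<kappa>\<^sub>x + (\<Sum>y\<in>\<sigma>(x). \<lambda>\<^sub>y) = 1\<close> (without \<open>\<mu>\<^sub>x\<close> at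
  the root); vertices may have infinitely many children. Such a \<open>P\<close> is automatically irreducible
  on \<open>pverts G\<close>, since neighbours communicate and \<open>G\<close> is connected.
\<close>

definition birth_death :: "'v pair_pre_digraph \<Rightarrow> 'v \<Rightarrow> ('v \<Rightarrow> 'v \<Rightarrow> real) \<Rightarrow> bool" where
  "birth_death G r P \<longleftrightarrow>
     (\<forall>x \<in> pverts G - {r}. P (parent G r x) x > 0 \<and> P x (parent G r x) > 0) \<and>
     (\<forall>x \<in> pverts G. P x x \<ge> 0) \<and>
     (\<forall>x \<in> pverts G. \<forall>y \<in> pverts G.
        x \<noteq> y \<and> \<not> (x \<noteq> r \<and> y = parent G r x) \<and> \<not> (y \<noteq> r \<and> x = parent G r y) \<longrightarrow> P x y = 0) \<and>
     (\<forall>x \<in> pverts G. (P x has_sum 1) (pverts G)) \<and>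
     (infinite (pverts G) \<longrightarrow>
        (\<lambda>x. \<Prod>y \<in> nonroot_path G r x. P (parent G r y) y / P y (parent G r y))
          summable_on pverts G)"

text \<open>\<open>X\<close> is a Markov chain on the state space \<open>S\<close> with transition probabilities \<open>P\<close>, started at \<open>x\<close>.\<close>

definition markov_chain_from ::
  "'w measure \<Rightarrow> 'v set \<Rightarrow> ('v \<Rightarrow> 'v \<Rightarrow> real) \<Rightarrow> 'v \<Rightarrow> (nat \<Rightarrow> 'w \<Rightarrow> 'v) \<Rightarrow> bool" where
  "markov_chain_from M S P x X \<longleftrightarrow>
     prob_space M \<and>
     (\<forall>t. X t \<in> measurable M (count_space S)) \<and>
     (AE \<omega> in M. X 0 \<omega> = x) \<and>
     (\<forall>t h. \<forall>y \<in> S. \<P>(\<omega> in M. \<forall>s\<le>t. X s \<omega> = h s) \<noteq> 0 \<longrightarrow>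
        \<P>(\<omega> in M. X (Suc t) \<omega> = y \<bar> \<forall>s\<le>t. X s \<omega> = h s) = P (h t) y)"

text \<open>The hitting time is \<open>\<infinity>\<close> (the infimum of the empty set) if \<open>y\<close> is never reached.\<close>

definition hitting_time :: "(nat \<Rightarrow> 'w \<Rightarrow> 'v) \<Rightarrow> 'v \<Rightarrow> 'w \<Rightarrow> ennreal" where
  "hitting_time X y \<omega> = (INF t \<in> {t. X t \<omega> = y}. of_nat t)"


section \<open>Variance and cut-off for extended nonnegative random variables\<close>

text \<open>
  Means are \<^const>\<open>nn_integral\<close>s, so infinite values of \<open>U\<close>, infinite means and infinite second
  moments all show up as the value \<open>\<infinity>\<close> of the variance; the lemma below relates this to the
  real-valued \<open>variance\<close>.
\<close>

definition nn_variance :: "'w measure \<Rightarrow> ('w \<Rightarrow> ennreal) \<Rightarrow> ennreal" where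
  "nn_variance M U =
     (\<integral>\<^sup>+\<omega>. e2ennreal ((enn2ereal (U \<omega>) - enn2ereal (\<integral>\<^sup>+\<omega>'. U \<omega>' \<partial>M))\<^sup>2) \<partial>M)"

lemma (in prob_space) nn_variance_eq_variance:
  fixes Y :: "'a \<Rightarrow> real"
  assumes "integrable M (\<lambda>\<omega>. (Y \<omega>)\<^sup>2)" "Y \<in> borel_measurable M" "\<And>\<omega>. Y \<omega> \<ge> 0"
  shows "nn_variance M (\<lambda>\<omega>. ennreal (Y \<omega>)) = ennreal (variance Y)"
proof -
  have int: "integrable M Y"
    using assms square_integrable_imp_integrable by blast
  have m: "(\<integral>\<^sup>+\<omega>. ennreal (Y \<omega>) \<partial>M) = ennreal (expectation Y)"
    using int assms by (intro nn_integral_eq_integral) auto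
  have nn: "expectation Y \<ge> 0" using assms by simp
  have "nn_variance M (\<lambda>\<omega>. ennreal (Y \<omega>)) = (\<integral>\<^sup>+\<omega>. ennreal ((Y \<omega> - expectation Y)\<^sup>2) \<partial>M)"
    unfolding nn_variance_def m using assms nn
    by (simp add: enn2ereal_ennreal e2ennreal_ereal)
  also have "\<dots> = ennreal (variance Y)"
  proof (rule nn_integral_eq_integral)
    show "integrable M (\<lambda>\<omega>. (Y \<omega> - expectation Y)\<^sup>2)"
      using int assms by (simp add: power2_diff)
  qed simp
  finally show ?thesis .
qed

definition converges_in_prob :: "(nat \<Rightarrow> 'w measure) \<Rightarrow> (nat \<Rightarrow> 'w \<Rightarrow> ennreal) \<Rightarrow> real \<Rightarrow> bool" where
  "converges_in_prob M U c \<longleftrightarrow>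
     (\<forall>\<epsilon>>0. (\<lambda>n. \<P>(\<omega> in M n. \<bar>enn2ereal (U n \<omega>) - ereal c\<bar> > ereal \<epsilon>)) \<longlonglongrightarrow> 0)"

definition cutoff_at_mean_times :: "(nat \<Rightarrow> 'w measure) \<Rightarrow> (nat \<Rightarrow> 'w \<Rightarrow> ennreal) \<Rightarrow> bool" where
  "cutoff_at_mean_times M U \<longleftrightarrow>
     converges_in_prob M (\<lambda>n \<omega>. U n \<omega> / (\<integral>\<^sup>+\<omega>'. U n \<omega>' \<partial>M n)) 1"


section \<open>Families indexed by a path\<close>

text \<open>
  The infinite path is \<open>v 0, v 1, \<dots>\<close> with \<open>v 0\<close> the root; the trees \<open>G a\<close> and transition
  probabilities \<open>P a\<close> are indexed by its vertices \<open>a = v n\<close>, \<open>n \<ge> 1\<close>. For each such \<open>a\<close> and each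
  vertex \<open>x\<close> of \<open>G a\<close>, the chain \<open>X a x\<close> on the probability space \<open>M a x\<close> is started at \<open>x\<close>.
  Values at \<open>a = v 0\<close> are irrelevant. Since \<open>v n\<close> has depth \<open>n\<close>, limits as \<open>a \<rightarrow> \<infinity>\<close> are limits
  as \<open>n \<rightarrow> \<infinity>\<close>.
\<close>

definition birth_death_family ::
  "(nat \<Rightarrow> 'v) \<Rightarrow> ('v \<Rightarrow> 'v pair_pre_digraph) \<Rightarrow> ('v \<Rightarrow> 'v \<Rightarrow> 'v \<Rightarrow> real) \<Rightarrow>
   ('v \<Rightarrow> 'v \<Rightarrow> 'w measure) \<Rightarrow> ('v \<Rightarrow> 'v \<Rightarrow> nat \<Rightarrow> 'w \<Rightarrow> 'v) \<Rightarrow> bool" where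
  "birth_death_family v G P M X \<longleftrightarrow>
     inj v \<and>
     (\<forall>n\<ge>1. let a = v n in
        rooted_tree (G a) (v 0) \<and>
        v ` {0..n} \<subseteq> pverts (G a) \<and>
        (\<forall>k\<in>{1..n}. parent (G a) (v 0) (v k) = v (k - 1)) \<and>
        birth_death (G a) (v 0) (P a) \<and>
        (\<forall>x \<in> pverts (G a). markov_chain_from (M a x) (pverts (G a)) (P a) x (X a x)))"

definition mean_hitting_time ::
  "('v \<Rightarrow> 'v \<Rightarrow> 'w measure) \<Rightarrow> ('v \<Rightarrow> 'v \<Rightarrow> nat \<Rightarrow> 'w \<Rightarrow> 'v) \<Rightarrow> 'v \<Rightarrow> 'v \<Rightarrow> 'v \<Rightarrow> ennreal" where
  "mean_hitting_time M X a x y = (\<integral>\<^sup>+\<omega>. hitting_time (X a x) y \<omega> \<partial>M a x)"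

text \<open>The supremum \<open>K\<^sub>a\<close> is taken in \<^typ>\<open>ennreal\<close>, since it may be infinite on an infinite branch.\<close>

definition drift_const ::
  "'v \<Rightarrow> ('v \<Rightarrow> 'v pair_pre_digraph) \<Rightarrow> ('v \<Rightarrow> 'v \<Rightarrow> 'v \<Rightarrow> real) \<Rightarrow>
   ('v \<Rightarrow> 'v \<Rightarrow> 'w measure) \<Rightarrow> ('v \<Rightarrow> 'v \<Rightarrow> nat \<Rightarrow> 'w \<Rightarrow> 'v) \<Rightarrow> 'v \<Rightarrow> ennreal" where
  "drift_const r G P M X a =
     (SUP b \<in> branch (G a) r (top_vertex (G a) r a).
        ennreal (P a b (parent (G a) r b)) * mean_hitting_time M X a b (parent (G a) r b))"

definition strong_drift ::
  "(nat \<Rightarrow> 'v) \<Rightarrow> ('v \<Rightarrow> 'v pair_pre_digraph) \<Rightarrow> ('v \<Rightarrow> 'v \<Rightarrow> 'v \<Rightarrow> real) \<Rightarrow>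
   ('v \<Rightarrow> 'v \<Rightarrow> 'w measure) \<Rightarrow> ('v \<Rightarrow> 'v \<Rightarrow> nat \<Rightarrow> 'w \<Rightarrow> 'v) \<Rightarrow> bool" where
  "strong_drift v G P M X \<longleftrightarrow>
     (\<exists>K>0. \<forall>n\<ge>1. let a = v n in
        (INF b \<in> branch (G a) (v 0) (top_vertex (G a) (v 0) a). P a b (parent (G a) (v 0) b)) \<ge> K) \<and>
     (\<lambda>n. (drift_const (v 0) G P M X (v n))\<^sup>2 / mean_hitting_time M X (v n) (v n) (v 0))
       \<longlonglongrightarrow> 0"

end

theory Submission
  imports Defs
begin

text \<open>
  Write \<open>h x\<close> for the mean time to reach the root from \<open>x\<close>, and \<open>m\<^sub>x = h x - h (p x)\<close> for its
  increment along an edge. As long as the chain has not reached the root, \<open>h (X\<^sub>t) + t\<close> is a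
  martingale, so that \<open>T - h a\<close>, for the hitting time \<open>T\<close> of the root from \<open>a\<close>, is a sum of orthogonal
  martingale increments. If the conditional second moments of \<open>h (X\<^sub>t\<^sub>+\<^sub>1) - h (X\<^sub>t)\<close> are at most \<open>C\<close>,
  this gives \<open>Var T \<le> C \<cdot> h a\<close>, and the variance of \<open>T / h a\<close> is at most \<open>C / h a\<close>.
  (\<open>sq_hit_le\<close> turns this into a pointwise inequality: \<open>h\<^sup>2 + C h\<close> dominates the second moment of \<open>T\<close>
  because it satisfies the corresponding one-step inequality.)

  The constant \<open>C\<close> comes from the drift condition. The path from \<open>b\<close> to the root passes through \<open>p b\<close>,
  so \<open>m\<^sub>b\<close> lies between \<open>0\<close> (\<open>mean_hit_parent_le\<close>) and the mean time from \<open>b\<close> to \<open>p b\<close>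
  (\<open>mean_hit_triangle\<close>), which is at most \<open>K / \<mu>\<^sub>b\<close>. One step of the chain lowers the mean of \<open>h\<close> by
  exactly \<open>1\<close>, and its only negative contribution is \<open>- \<mu>\<^sub>b m\<^sub>b \<ge> - K\<close>; hence the mean of the absolute
  increment is at most \<open>2 K\<close>. As each increment is at most \<open>K / c\<close> for a lower bound \<open>c\<close> of the \<open>\<mu>\<^sub>b\<close>,
  its second moment is at most \<open>C = 2 K\<^sup>2 / c\<close> (\<open>increment_variance\<close>). So the variance of \<open>T / h a\<close> is
  bounded by \<open>(2 / c) \<cdot> K\<^sup>2 / h a\<close>, which tends to \<open>0\<close>, and cut-off follows from Chebyshev's inequality.

  For this \<open>h\<close> has to be finite. The weights \<open>\<Prod> \<lambda>\<^sub>y / \<mu>\<^sub>y\<close> form a reversible, hence stationary, measure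
  of finite mass, and Kac's inequality (\<open>kac_inequality\<close>) bounds the mean return time to the root;
  finiteness then propagates from each vertex to its children. This also rules out \<open>K = \<infinity>\<close> in the
  limit, since \<open>K\<^sup>2 / h a\<close> would be infinite.

  All estimates are made on the transition kernel, for the probabilities that the target is
  avoided during the first \<open>t\<close> steps, by induction on \<open>t\<close>. This takes the place of the strong Markov
  property and of the independence of successive passage times.
\<close>

section \<open>Paths to the root of a tree\<close>

lemma vwalk_with_proj_iff:
  "vwalk xs (with_proj G) \<longleftrightarrow>
     xs \<noteq> [] \<and> set xs \<subseteq> pverts G \<and> successively (\<lambda>x y. (x, y) \<in> parcs G) xs"
proof -
  have "set (vwalk_arcs xs) \<subseteq> parcs G \<longleftrightarrow> successively (\<lambda>x y. (x, y) \<in> parcs G) xs"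
    by (induction xs rule: vwalk_arcs.induct) auto
  then show ?thesis by (auto simp: vwalk_def)
qed

lemma vwalk_imp_awalk:
  assumes "vwalk xs (with_proj G)"
  shows "pre_digraph.awalk (with_proj G) (hd xs) (vwalk_arcs xs) (last xs)
     \<and> pre_digraph.awalk_verts (with_proj G) (hd xs) (vwalk_arcs xs) = xs"
proof -
  have "pcas (hd xs) (vwalk_arcs xs) (last xs) \<and> pawalk_verts (hd xs) (vwalk_arcs xs) = xs"
    if "xs \<noteq> []" using that
    by (induction xs rule: vwalk_arcs.induct) auto
  with assms show ?thesis
    by (auto simp: vwalk_def pre_digraph.awalk_def cas_with_proj_eq awalk_verts_with_proj_eq)
qed

text \<open>
  A longer walk would be a cycle of at least three edges. What remains are single vertices and the
  walks \<open>x, y, x\<close> back and forth along an edge.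
\<close>
lemma undirected_tree_no_closed_walk:
  assumes "undirected_tree G" "vwalk xs (with_proj G)" "hd xs = last xs" "distinct (tl xs)"
  shows "length xs \<le> 3"
proof (rule ccontr)
  assume "\<not> length xs \<le> 3"
  then have len: "3 \<le> length (vwalk_arcs xs)"
    using vwalk_length_simp[of xs] unfolding vwalk_length_def by linarith
  then have "vwalk_arcs xs \<noteq> []" by auto
  with vwalk_imp_awalk[OF assms(2)] assms(3,4)
  have "pre_digraph.cycle (with_proj G) (vwalk_arcs xs)"
    unfolding pre_digraph.cycle_def by metis
  with len assms(1) show False by (auto simp: undirected_tree_def)
qed

lemma vpath_hd_eq_last: "vpath xs H \<Longrightarrow> hd xs = last xs \<Longrightarrow> tl xs = []"
  by (cases xs) (auto simp: vpath_def vwalk_def split: if_splits)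

text \<open>
  Two paths with common ends that leave their first vertex along different edges meet again;
  up to the first vertex of one that lies on the other they enclose a cycle.
\<close>
lemma undirected_tree_path_unique:
  assumes "undirected_tree G"
  shows "vpath xs (with_proj G) \<Longrightarrow> vpath ys (with_proj G) \<Longrightarrow> hd xs = hd ys \<Longrightarrow>
     last xs = last ys \<Longrightarrow> xs = ys"
proof (induction xs arbitrary: ys)
  case Nil
  then show ?case by (auto simp: vpath_def vwalk_def)
next
  case (Cons x xs)
  let ?E = "\<lambda>x y. (x, y) \<in> parcs G"
  have sym: "?E a b \<Longrightarrow> ?E b a" for a b
    using assms by (auto simp: undirected_tree_def pair_bidirected_digraph_def pair_sym_digraph_def
        pair_sym_digraph_axioms_def symmetric_def sym_def)
  obtain zs where ys: "ys = x # zs"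
    using Cons.prems by (cases ys) (auto simp: vpath_def vwalk_def)
  show ?case
  proof (cases "xs = [] \<or> zs = []")
    case True
    then have "hd (x # xs) = last (x # xs) \<and> hd (x # zs) = last (x # zs)"
      using Cons.prems(4) unfolding ys by (metis last.simps list.sel(1))
    then have "xs = [] \<and> zs = []"
      using vpath_hd_eq_last[OF Cons.prems(1)] vpath_hd_eq_last[OF Cons.prems(2)[unfolded ys]]
      by simp
    then show ?thesis by (simp add: ys)
  next
    case False
    have walks: "vwalk (x # xs) (with_proj G)" "vwalk (x # zs) (with_proj G)"
        "distinct (x # xs)" "distinct (x # zs)"
      using Cons.prems ys by (auto simp: vpath_def)
    show ?thesis
    proof (cases "hd xs = hd zs")
      case True
      have "vpath xs (with_proj G)" "vpath zs (with_proj G)"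
        using walks False by (auto simp: vpath_def vwalk_with_proj_iff successively_Cons)
      then have "xs = zs" using Cons.IH[of zs] Cons.prems ys False True by auto
      then show ?thesis by (simp add: ys)
    next
      case neq: False
      have "last xs \<in> set zs" using Cons.prems ys False by auto
      then obtain as w bs where xs: "xs = as @ w # bs" and w: "w \<in> set zs"
          and as: "\<forall>a\<in>set as. a \<notin> set zs"
        using split_list_first_prop[of xs "\<lambda>a. a \<in> set zs"] False by (metis last_in_set)
      obtain cs ds where zs: "zs = cs @ w # ds" using w by (auto dest: split_list)
      \<comment> \<open>Out along the first path as far as \<open>w\<close>, and back along the second one.\<close>
      let ?c = "x # as @ w # rev cs @ [x]"
      have "successively ?E (x # as @ [w])" "successively ?E (x # cs @ [w])"
        using walks(1,2) successively_append_iff[of ?E "x # as @ [w]" bs]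
          successively_append_iff[of ?E "x # cs @ [w]" ds]
        by (simp_all add: vwalk_with_proj_iff xs zs del: successively.simps)
      then have "successively ?E (x # as @ [w])" "successively ?E (w # rev cs @ [x])"
        using successively_rev[of ?E "x # cs @ [w]"]
          successively_mono[of ?E "x # cs @ [w]" "\<lambda>x y. ?E y x"] sym
        by (simp_all del: successively.simps successively_rev)
      moreover have "successively ?E (us @ u # vs)"
        if "successively ?E (us @ [u])" "successively ?E (u # vs)" for us u vs
        using that by (cases vs) (auto simp: successively_append_iff)
      ultimately have "successively ?E ?c"
        by (metis append_Cons)
      then have "vwalk ?c (with_proj G)"
        using walks by (auto simp: vwalk_with_proj_iff xs zs)
      moreover have "distinct (tl ?c)" using walks as by (auto simp: xs zs)
      ultimately have "length ?c \<le> 3"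
        using undirected_tree_no_closed_walk[OF assms, of ?c] by simp
      with neq show ?thesis by (auto simp: xs zs)
    qed
  qed
qed

context
  fixes G :: "'v pair_pre_digraph" and r :: 'v
  assumes tree: "rooted_tree G r"
begin

lemma tree_graph: "undirected_tree G" "r \<in> pverts G" "pair_bidirected_digraph G"
  using tree by (auto simp: rooted_tree_def undirected_tree_def)

interpretation pair_bidirected_digraph G by (rule tree_graph)

lemma root_path:
  assumes "x \<in> pverts G"
  shows "vpath (root_path G r x) (with_proj G)" "hd (root_path G r x) = x"
    "last (root_path G r x) = r"
proof -
  have "strongly_connected (mk_symmetric (with_proj G))"
    using tree_graph(1) by (simp add: undirected_tree_def connected_def)
  then have "x \<rightarrow>\<^sup>*\<^bsub>mk_symmetric (with_proj G)\<^esub> r"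
    using assms tree_graph(2) by (auto simp: strongly_connected_def)
  then have "x \<rightarrow>\<^sup>*\<^bsub>with_proj G\<^esub> r"
    using reachable_mk_symmetric_eq pair_sym_arcs by simp
  then have ex: "\<exists>xs. vpath xs (with_proj G) \<and> hd xs = x \<and> last xs = r"
    by (simp add: reachable_vpath_conv)
  have "\<exists>!xs. vpath xs (with_proj G) \<and> hd xs = x \<and> last xs = r"
    using ex undirected_tree_path_unique[OF tree_graph(1)] by (metis (no_types, lifting))
  from theI'[OF this] show "vpath (root_path G r x) (with_proj G)" "hd (root_path G r x) = x"
      "last (root_path G r x) = r"
    by (simp_all add: root_path_def)
qed

lemma root_path_eqI:
  assumes "vpath xs (with_proj G)" "hd xs = x" "last xs = r"
  shows "root_path G r x = xs"
proof -
  have "x \<in> pverts G" using assms by (cases xs) (auto simp: vpath_def vwalk_def)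
  from root_path[OF this] show ?thesis
    using assms by (intro undirected_tree_path_unique[OF tree_graph(1)]) simp_all
qed

lemma root_path_root: "root_path G r r = [r]"
  by (rule root_path_eqI) (auto simp: vpath_def vwalk_with_proj_iff tree_graph(2))

text \<open>
  By uniqueness of paths, the only neighbour of \<open>x\<close> on its path to the root is the next vertex of this
  path. Depth, ancestors and branches are computed from the resulting recursion.
\<close>
lemma parent_root_path:
  assumes x: "x \<in> pverts G" "x \<noteq> r"
  shows "parent G r x \<in> pverts G" "root_path G r x = x # root_path G r (parent G r x)"
proof -
  note rp = root_path[OF x(1)]
  obtain y ys where path: "root_path G r x = x # y # ys"
  proof (cases "root_path G r x")
    case Nil then show ?thesis using rp by (auto simp: vpath_def vwalk_def)
  next
    case (Cons a as) with that rp x(2) show ?thesis by (cases as) auto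
  qed
  have "vpath (y # ys) (with_proj G)" "last (y # ys) = r"
    using rp path by (auto simp: vpath_def vwalk_with_proj_iff)
  then have y: "root_path G r y = y # ys" by (intro root_path_eqI) auto
  have "y \<in> pverts G" "(x, y) \<in> parcs G"
    using rp path by (auto simp: vpath_def vwalk_with_proj_iff)
  note y = y this
  have "parent G r x = y"
    unfolding parent_def
  proof (rule the_equality)
    show "(x, y) \<in> parcs G \<and> tree_le G r y x" using y path by (simp add: tree_le_def)
  next
    fix z assume z: "(x, z) \<in> parcs G \<and> tree_le G r z x"
    then have "z \<noteq> x" using no_loops by fastforce
    with z path have "z \<in> set (y # ys)" by (simp add: tree_le_def)
    then obtain as bs where split: "y # ys = as @ z # bs" by (meson split_list)
    \<comment> \<open>The path from \<open>z\<close> to the root, prolonged by the edge from \<open>x\<close> to \<open>z\<close>, is again a path.\<close>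
    have "vpath (x # z # bs) (with_proj G)" "last (x # z # bs) = r"
      using rp path split z
      by (auto simp: vpath_def vwalk_with_proj_iff successively_append_iff successively_Cons
          split: if_splits)
    then have "root_path G r x = x # z # bs" by (intro root_path_eqI) auto
    with path show "z = y" by simp
  qed
  then show "parent G r x \<in> pverts G" "root_path G r x = x # root_path G r (parent G r x)"
    using y path by auto
qed

lemma depth_root: "depth G r r = 0"
  by (simp add: depth_def root_path_root)

lemma depth_parent:
  assumes "x \<in> pverts G" "x \<noteq> r"
  shows "depth G r x = Suc (depth G r (parent G r x))"
proof -
  have "root_path G r (parent G r x) \<noteq> []"
    using root_path(1)[OF parent_root_path(1)[OF assms]] by (auto simp: vpath_def vwalk_def)
  then show ?thesis by (simp add: depth_def parent_root_path(2)[OF assms])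
qed

lemma rooted_tree_induct [consumes 1, case_names root parent]:
  assumes "x \<in> pverts G" "Q r"
    and "\<And>x. x \<in> pverts G \<Longrightarrow> x \<noteq> r \<Longrightarrow> Q (parent G r x) \<Longrightarrow> Q x"
  shows "Q x"
  using assms(1)
proof (induction "depth G r x" arbitrary: x rule: less_induct)
  case less
  then show ?case
    using assms(2,3) depth_parent parent_root_path(1) by (cases "x = r") auto
qed

lemma nonroot_path_root: "nonroot_path G r r = {}"
  by (simp add: nonroot_path_def depth_root)

lemma nonroot_path_parent:
  assumes "x \<in> pverts G" "x \<noteq> r"
  shows "nonroot_path G r x = insert x (nonroot_path G r (parent G r x))"
  unfolding nonroot_path_def depth_parent[OF assms] lessThan_Suc_eq_insert_0 image_insert image_image
  by (simp add: funpow_Suc_right del: funpow.simps(2))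

lemma set_root_path:
  assumes "x \<in> pverts G"
  shows "set (root_path G r x) = insert r (nonroot_path G r x)"
  using assms
  by (induction x rule: rooted_tree_induct)
    (auto simp: root_path_root nonroot_path_root nonroot_path_parent parent_root_path(2))

lemma nonroot_path_subset:
  assumes "x \<in> pverts G"
  shows "nonroot_path G r x \<subseteq> pverts G - {r}"
  using assms
  by (induction x rule: rooted_tree_induct) (auto simp: nonroot_path_root nonroot_path_parent)

lemma not_in_nonroot_path_parent:
  assumes "x \<in> pverts G" "x \<noteq> r"
  shows "x \<notin> nonroot_path G r (parent G r x)"
  using root_path(1)[OF assms(1)] set_root_path[OF parent_root_path(1)[OF assms]]
  by (auto simp: parent_root_path(2)[OF assms] vpath_def)

lemma branch_eq:
  assumes "b \<noteq> r"
  shows "branch G r b = {x \<in> pverts G. b \<in> nonroot_path G r x}"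
  using assms by (auto simp: branch_def tree_le_def set_root_path)

lemma funpow_depth_parent:
  assumes "x \<in> pverts G"
  shows "(parent G r ^^ depth G r x) x = r"
  using assms
  by (induction x rule: rooted_tree_induct)
    (auto simp: depth_root depth_parent funpow_Suc_right simp del: funpow.simps(2))

lemma top_vertex:
  assumes "x \<in> pverts G" "x \<noteq> r"
  shows "top_vertex G r x \<in> nonroot_path G r x" "parent G r (top_vertex G r x) = r"
proof -
  show "top_vertex G r x \<in> nonroot_path G r x"
    by (auto simp: top_vertex_def nonroot_path_def depth_parent[OF assms])
  show "parent G r (top_vertex G r x) = r"
    using funpow_depth_parent[OF assms(1)] by (simp add: top_vertex_def depth_parent[OF assms])
qed

text \<open>
  A chain that moves along edges can leave the branch of the top vertex only through the root.
\<close>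
lemma top_branch:
  assumes a: "a \<in> pverts G" "a \<noteq> r"
  defines "B \<equiv> branch G r (top_vertex G r a)"
  shows "a \<in> B" "B \<subseteq> pverts G - {r}"
    and "\<And>x. x \<in> B \<Longrightarrow> parent G r x \<in> insert r B"
    and "\<And>x. x \<in> pverts G \<Longrightarrow> x \<noteq> r \<Longrightarrow> parent G r x \<in> B \<Longrightarrow> x \<in> B"
proof -
  have "top_vertex G r a \<noteq> r" using top_vertex(1)[OF a] nonroot_path_subset[OF a(1)] by auto
  note B = B_def[unfolded branch_eq[OF this]]
  show "a \<in> B" using top_vertex(1)[OF a] a by (simp add: B)
  show sub: "B \<subseteq> pverts G - {r}" by (auto simp: B nonroot_path_root)
  show "parent G r x \<in> insert r B" if "x \<in> B" for x
  proof -
    have "x \<in> pverts G" "x \<noteq> r" using that sub by auto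
    with that show ?thesis
      using top_vertex(2)[OF a] parent_root_path(1)[of x] nonroot_path_parent[of x]
      by (auto simp: B)
  qed
  show "x \<in> B" if "x \<in> pverts G" "x \<noteq> r" "parent G r x \<in> B" for x
    using that by (auto simp: B nonroot_path_parent)
qed

end

section \<open>Survival probabilities of a Markov kernel\<close>

text \<open>
  The probability that the chain with kernel \<open>k\<close>, started at \<open>x\<close>, avoids \<open>z\<close> at the times \<open>0, \<dots>, t\<close>,
  that is, that the hitting time of \<open>z\<close> exceeds \<open>t\<close>.
\<close>
primrec survival :: "('v \<Rightarrow> 'v pmf) \<Rightarrow> 'v \<Rightarrow> nat \<Rightarrow> 'v \<Rightarrow> ennreal" where
  "survival k z 0 x = (if x = z then 0 else 1)"
| "survival k z (Suc t) x = (if x = z then 0 else \<integral>\<^sup>+y. survival k z t y \<partial>k x)"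

lemma survival_step: "x \<noteq> z \<Longrightarrow> survival k z (Suc t) x = (\<integral>\<^sup>+y. survival k z t y \<partial>k x)"
  by simp

declare survival.simps(2) [simp del]

text \<open>The mean and the second moment of a hitting time \<open>T\<close> are sums over its tails \<open>T > t\<close>.\<close>
definition mean_hit :: "('v \<Rightarrow> 'v pmf) \<Rightarrow> 'v \<Rightarrow> 'v \<Rightarrow> ennreal" where
  "mean_hit k z x = (\<Sum>t. survival k z t x)"

definition sq_hit :: "('v \<Rightarrow> 'v pmf) \<Rightarrow> 'v \<Rightarrow> 'v \<Rightarrow> ennreal" where
  "sq_hit k z x = (\<Sum>t. of_nat (2 * t + 1) * survival k z t x)"

lemma survival_target [simp]: "survival k z t z = 0"
  by (cases t) (simp_all add: survival.simps(2))

lemma mean_hit_target [simp]: "mean_hit k z z = 0"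
  by (simp add: mean_hit_def)

lemma survival_decreasing: "survival k z (Suc t) x \<le> survival k z t x"
proof (induction t arbitrary: x)
  case 0
  have "(\<integral>\<^sup>+y. survival k z 0 y \<partial>k x) \<le> (\<integral>\<^sup>+y. 1 \<partial>k x)"
    by (intro nn_integral_mono) auto
  then have "(\<integral>\<^sup>+y. survival k z 0 y \<partial>k x) \<le> 1" by simp
  then show ?case by (cases "x = z") (simp_all add: survival_step)
next
  case (Suc t)
  then show ?case
    by (cases "x = z") (simp_all add: survival_step nn_integral_mono)
qed

text \<open>
  First-step analysis for the mean, and for the hitting time truncated at \<open>n\<close>; the truncated version
  is the one that supports inductions without any finiteness assumption.
\<close>
lemma mean_hit_step:
  assumes "x \<noteq> z"
  shows "mean_hit k z x = 1 + (\<integral>\<^sup>+y. mean_hit k z y \<partial>k x)"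
proof -
  have "(\<integral>\<^sup>+y. mean_hit k z y \<partial>k x) = (\<Sum>t. survival k z (Suc t) x)"
    using assms by (simp add: mean_hit_def nn_integral_suminf survival_step)
  moreover have "mean_hit k z x = (\<Sum>t. survival k z (Suc t) x) + survival k z 0 x"
    unfolding mean_hit_def by (subst suminf_offset[of _ 1]) auto
  ultimately show ?thesis using assms by (simp add: add.commute)
qed

lemma truncated_mean_step:
  assumes "x \<noteq> z"
  shows "(\<Sum>t<Suc n. survival k z t x) = 1 + (\<integral>\<^sup>+y. (\<Sum>t<n. survival k z t y) \<partial>k x)"
  using assms by (subst sum.lessThan_Suc_shift) (simp add: nn_integral_sum survival_step)

lemma truncated_mean_le: "(\<Sum>t<n. survival k z t x) \<le> mean_hit k z x"
  unfolding mean_hit_def by (rule sum_le_suminf) auto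

text \<open>
  Going to \<open>z\<close> by way of \<open>q\<close> takes at least as long as going to \<open>z\<close> directly. The induction truncates the
  time to \<open>z\<close> and keeps the full time to \<open>q\<close>.
\<close>
lemma mean_hit_triangle: "mean_hit k z x \<le> mean_hit k q x + mean_hit k z q"
proof -
  have "(\<Sum>t<n. survival k z t x) \<le> mean_hit k q x + (\<Sum>t<n. survival k z t q)" for n
  proof (induction n arbitrary: x)
    case (Suc n)
    consider "x = q" | "x = z" | "x \<noteq> q" "x \<noteq> z" by blast
    then show ?case
    proof cases
      case 3
      have "(\<Sum>t<Suc n. survival k z t x)
          \<le> 1 + (\<integral>\<^sup>+y. mean_hit k q y + (\<Sum>t<n. survival k z t q) \<partial>k x)"
        unfolding truncated_mean_step[OF 3(2)] by (intro add_left_mono nn_integral_mono Suc.IH)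
      also have "\<dots> = mean_hit k q x + (\<Sum>t<n. survival k z t q)"
        by (simp add: mean_hit_step[OF 3(1)] nn_integral_add add.assoc)
      also have "\<dots> \<le> mean_hit k q x + (\<Sum>t<Suc n. survival k z t q)"
        by (intro add_left_mono) simp
      finally show ?thesis .
    qed auto
  qed simp
  then have "(\<Sum>t<n. survival k z t x) \<le> mean_hit k q x + mean_hit k z q" for n
    by (rule order_trans) (intro add_left_mono truncated_mean_le)
  then show ?thesis unfolding mean_hit_def[of k z x] by (rule suminf_le_const[OF summableI])
qed

text \<open>
  The \<open>w\<close>-mass of the paths that avoid \<open>z\<close> up to time \<open>t\<close> decreases, in each step, by the mass of the paths
  that would have to come from \<open>z\<close> by stationarity. The total loss is at most the initial mass, and
  it is \<open>w z\<close> times the sum over \<open>t\<close> of the probabilities not to have returned to \<open>z\<close>.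
\<close>
lemma kac_inequality:
  fixes w :: "'v \<Rightarrow> ennreal"
  assumes stationary: "\<And>y. (\<integral>\<^sup>+x. w x * pmf (k x) y \<partial>count_space UNIV) = w y"
  shows "w z * (\<integral>\<^sup>+y. mean_hit k z y \<partial>k z) \<le> (\<integral>\<^sup>+x. w x \<partial>count_space UNIV)"
proof -
  let ?C = "count_space UNIV"
  define A where "A t = (\<integral>\<^sup>+x. w x * survival k z t x \<partial>?C)" for t
  have split: "(\<integral>\<^sup>+x. f x \<partial>?C) = f z + (\<integral>\<^sup>+x. (if x = z then 0 else f x) \<partial>?C)"
    for f :: "'v \<Rightarrow> ennreal"
  proof -
    have "(\<integral>\<^sup>+x. f x \<partial>?C) = (\<integral>\<^sup>+x. f x * indicator {z} x + (if x = z then 0 else f x) \<partial>?C)"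
      by (intro nn_integral_cong) auto
    also have "\<dots> = f z + (\<integral>\<^sup>+x. (if x = z then 0 else f x) \<partial>?C)"
      by (subst nn_integral_add) (simp_all add: nn_integral_indicator_singleton)
    finally show ?thesis .
  qed
  have step: "A t = w z * (\<integral>\<^sup>+y. survival k z t y \<partial>k z) + A (Suc t)" for t
  proof -
    have "A t = (\<integral>\<^sup>+y. (\<integral>\<^sup>+x. w x * pmf (k x) y * survival k z t y \<partial>?C) \<partial>?C)"
      by (simp add: A_def nn_integral_multc stationary)
    also have "\<dots> = (\<integral>\<^sup>+x. (\<integral>\<^sup>+y. w x * pmf (k x) y * survival k z t y \<partial>?C) \<partial>?C)"
      using nn_integral_fst_count_space[of "\<lambda>(x, y). w x * pmf (k x) y * survival k z t y"]
        nn_integral_snd_count_space[of "\<lambda>(x, y). w x * pmf (k x) y * survival k z t y"]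
      by simp
    also have "\<dots> = (\<integral>\<^sup>+x. w x * (\<integral>\<^sup>+y. survival k z t y \<partial>k x) \<partial>?C)"
      by (simp add: nn_integral_measure_pmf nn_integral_cmult mult.assoc)
    also have "\<dots> = w z * (\<integral>\<^sup>+y. survival k z t y \<partial>k z) + A (Suc t)"
      unfolding A_def split[of "\<lambda>x. w x * (\<integral>\<^sup>+y. survival k z t y \<partial>k x)"]
      by (intro arg_cong2[where f = "(+)"] refl nn_integral_cong) (simp add: survival.simps(2))
    finally show ?thesis .
  qed
  have "(\<Sum>t<n. w z * (\<integral>\<^sup>+y. survival k z t y \<partial>k z)) + A n = A 0" for n
  proof (induction n)
    case (Suc n)
    then show ?case by (subst (asm) step[of n]) (simp only: sum.lessThan_Suc add.assoc)
  qed simp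
  then have "(\<Sum>t<n. w z * (\<integral>\<^sup>+y. survival k z t y \<partial>k z)) \<le> A 0" for n
    by (metis le_iff_add)
  then have "(\<Sum>t. w z * (\<integral>\<^sup>+y. survival k z t y \<partial>k z)) \<le> A 0"
    by (rule suminf_le_const[OF summableI])
  also have "A 0 \<le> (\<integral>\<^sup>+x. w x \<partial>?C)"
    unfolding A_def by (intro nn_integral_mono) auto
  finally show ?thesis
    by (simp add: mean_hit_def nn_integral_suminf ennreal_suminf_cmult)
qed

text \<open>
  Where the mean hitting time is finite, it can be treated as a real random variable at the next
  position of the chain.
\<close>
lemma mean_hit_real_step:
  assumes "x \<noteq> z" "mean_hit k z x < \<infinity>"
  shows "integrable (k x) (\<lambda>y. enn2real (mean_hit k z y))"
    and "measure_pmf.expectation (k x) (\<lambda>y. enn2real (mean_hit k z y))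
           = enn2real (mean_hit k z x) - 1"
    and "(\<integral>\<^sup>+y. mean_hit k z y \<partial>k x) = ennreal (enn2real (mean_hit k z x) - 1)"
proof -
  have fin: "(\<integral>\<^sup>+y. mean_hit k z y \<partial>k x) < \<infinity>"
    using assms(2) unfolding mean_hit_step[OF assms(1)] by (simp add: ennreal_add_less_top)
  then have ae: "AE y in k x. mean_hit k z y < \<infinity>"
    using nn_integral_noteq_infinite[of "mean_hit k z" "k x"] by (auto simp: less_top)
  have eq: "(\<integral>\<^sup>+y. ennreal (enn2real (mean_hit k z y)) \<partial>k x) = (\<integral>\<^sup>+y. mean_hit k z y \<partial>k x)"
    by (intro nn_integral_cong_AE) (use ae in eventually_elim, simp)
  show int: "integrable (k x) (\<lambda>y. enn2real (mean_hit k z y))"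
    by (rule integrableI_nonneg) (use eq fin in auto)
  have E: "ennreal (measure_pmf.expectation (k x) (\<lambda>y. enn2real (mean_hit k z y)))
      = (\<integral>\<^sup>+y. mean_hit k z y \<partial>k x)"
    using nn_integral_eq_integral[OF int] eq by simp
  from E[symmetric] have "mean_hit k z x
      = ennreal (1 + measure_pmf.expectation (k x) (\<lambda>y. enn2real (mean_hit k z y)))"
    by (simp add: mean_hit_step[OF assms(1)])
  moreover have "0 \<le> measure_pmf.expectation (k x) (\<lambda>y. enn2real (mean_hit k z y))"
    by simp
  ultimately show "measure_pmf.expectation (k x) (\<lambda>y. enn2real (mean_hit k z y))
           = enn2real (mean_hit k z x) - 1" by (simp del: ennreal_plus)
  with E show "(\<integral>\<^sup>+y. mean_hit k z y \<partial>k x) = ennreal (enn2real (mean_hit k z x) - 1)"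
    by simp
qed

text \<open>
  With \<open>h (X\<^sub>t) + t\<close> a martingale up to the hitting time \<open>T\<close>, the variance of \<open>T\<close> is the mean of the sum of
  the conditional variances along the way, hence at most \<open>C\<close> times the mean of \<open>T\<close>. In terms of the
  kernel: \<open>f = h\<^sup>2 + C h\<close> satisfies the one-step inequality \<open>super\<close>, for which the second moment is the
  minimal solution.
\<close>
lemma sq_hit_le:
  fixes k :: "'v \<Rightarrow> 'v pmf" and z :: 'v and C :: real
  defines "h \<equiv> \<lambda>x. enn2real (mean_hit k z x)"
  assumes closed: "\<And>x. x \<in> D \<Longrightarrow> set_pmf (k x) \<subseteq> insert z D" and zD: "z \<notin> D"
    and fin: "\<And>x. x \<in> D \<Longrightarrow> mean_hit k z x < \<infinity>"
    and C: "0 \<le> C"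
    and incr: "\<And>x. x \<in> D \<Longrightarrow> integrable (k x) (\<lambda>y. (h y - h x)\<^sup>2)"
      "\<And>x. x \<in> D \<Longrightarrow> measure_pmf.expectation (k x) (\<lambda>y. (h y - h x)\<^sup>2) \<le> C"
    and x: "x \<in> D"
  shows "sq_hit k z x \<le> ennreal ((h x)\<^sup>2 + C * h x)"
proof -
  define f where "f x = (h x)\<^sup>2 + C * h x" for x
  have h0: "h x \<ge> 0" for x by (simp add: h_def)
  have f0: "f x \<ge> 0" for x using C h0 by (simp add: f_def)
  have super: "1 + (\<integral>\<^sup>+y. ennreal (f y) \<partial>k x) + 2 * (\<integral>\<^sup>+y. mean_hit k z y \<partial>k x) \<le> ennreal (f x)"
    if "x \<in> D" for x
  proof -
    from that zD have xz: "x \<noteq> z" by auto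
    have step: "integrable (k x) h" "measure_pmf.expectation (k x) h = h x - 1"
      using mean_hit_real_step(1,2)[OF xz fin[OF that]] by (simp_all add: h_def)
    have sq: "(h y)\<^sup>2 = (h y - h x)\<^sup>2 + 2 * h x * h y - h x * h x" for y
      by (simp add: power2_eq_square algebra_simps)
    have int2: "integrable (k x) (\<lambda>y. (h y)\<^sup>2)"
      unfolding sq by (intro Bochner_Integration.integrable_diff Bochner_Integration.integrable_add
          incr that integrable_mult_right step) auto
    have int: "integrable (k x) f"
      unfolding f_def using int2 step(1) by auto
    have "measure_pmf.expectation (k x) (\<lambda>y. (h y)\<^sup>2)
        = measure_pmf.expectation (k x) (\<lambda>y. (h y - h x)\<^sup>2) + 2 * h x * (h x - 1) - h x * h x"
      unfolding sq using step incr(1)[OF that] by simp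
    moreover have Ef: "measure_pmf.expectation (k x) f
        = measure_pmf.expectation (k x) (\<lambda>y. (h y)\<^sup>2) + C * (h x - 1)"
      unfolding f_def[abs_def] using step int2 by simp
    ultimately have E: "1 + measure_pmf.expectation (k x) f + 2 * (h x - 1) \<le> f x"
      using incr(2)[OF that] Ef by (simp add: f_def algebra_simps power2_eq_square)
    have "h x - 1 \<ge> 0" unfolding step(2)[symmetric] by (simp add: h0)
    have M: "(\<integral>\<^sup>+y. mean_hit k z y \<partial>k x) = ennreal (h x - 1)"
      using mean_hit_real_step(3)[OF xz fin[OF that]] by (simp add: h_def)
    have "1 + (\<integral>\<^sup>+y. ennreal (f y) \<partial>k x) + 2 * (\<integral>\<^sup>+y. mean_hit k z y \<partial>k x)
        = ennreal (1 + measure_pmf.expectation (k x) f + 2 * (h x - 1))"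
    proof -
      have "0 \<le> measure_pmf.expectation (k x) f" by (simp add: f0)
      moreover have "2 * ennreal (h x - 1) = ennreal (2 * (h x - 1))"
        using \<open>h x - 1 \<ge> 0\<close> by (simp only: ennreal_mult' ennreal_numeral)
      ultimately show ?thesis
        using \<open>h x - 1 \<ge> 0\<close>
        by (subst ennreal_plus, simp, simp)
          (simp only: ennreal_plus ennreal_1 M nn_integral_eq_integral[OF int] f0 zero_le_one AE_I2)
    qed
    also have "\<dots> \<le> ennreal (f x)" by (rule ennreal_leI[OF E])
    finally show ?thesis .
  qed
  \<comment> \<open>Shifting the weights \<open>2 t + 1\<close> by one step produces the mean hitting time as an extra term.\<close>
  have odd: "of_nat (2 * Suc t + 1) * s = of_nat (2 * t + 1) * s + 2 * s" for t and s :: ennreal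
  proof -
    have "2 * Suc t + 1 = (2 * t + 1) + 2" by simp
    then show ?thesis by (simp only: of_nat_add distrib_right of_nat_numeral)
  qed
  have "(\<Sum>t<n. of_nat (2 * t + 1) * survival k z t x) \<le> ennreal (f x)" if "x \<in> insert z D" for n x
    using that
  proof (induction n arbitrary: x)
    case (Suc n)
    show ?case
    proof (cases "x = z")
      case True
      then show ?thesis by (simp only: survival_target mult_zero_right sum.neutral_const zero_le)
    next
      case False
      with Suc.prems have xD: "x \<in> D" by simp
      have "(\<Sum>t<Suc n. of_nat (2 * t + 1) * survival k z t x)
         = 1 + (\<Sum>t<n. of_nat (2 * t + 1) * survival k z (Suc t) x + 2 * survival k z (Suc t) x)"
        using False by (subst sum.lessThan_Suc_shift) (simp only: odd survival.simps(1) if_False, simp)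
      also have "\<dots> = 1 + (\<integral>\<^sup>+y. (\<Sum>t<n. of_nat (2 * t + 1) * survival k z t y) \<partial>k x)
          + 2 * (\<integral>\<^sup>+y. (\<Sum>t<n. survival k z t y) \<partial>k x)"
        using False
        by (simp add: sum.distrib sum_distrib_left nn_integral_sum nn_integral_cmult add.assoc survival_step)
      also have "\<dots> \<le> 1 + (\<integral>\<^sup>+y. ennreal (f y) \<partial>k x) + 2 * (\<integral>\<^sup>+y. mean_hit k z y \<partial>k x)"
        using closed[OF xD]
        by (intro add_mono mult_left_mono nn_integral_mono truncated_mean_le order_refl
            nn_integral_mono_AE AE_pmfI Suc.IH) auto
      also have "\<dots> \<le> ennreal (f x)" by (rule super[OF xD])
      finally show ?thesis .
    qed
  qed simp
  then show ?thesis
    unfolding sq_hit_def f_def using x by (intro suminf_le_const[OF summableI]) auto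
qed

section \<open>Moments of hitting times of a Markov chain\<close>

text \<open>
  The Markov property conditions on a full history \<open>h\<close> up to time \<open>t\<close>. So the induction over the number \<open>m\<close>
  of steps still to be made has to be for all histories at once: the next step extends \<open>h\<close> by one of
  countably many states, which partitions the event.
\<close>
lemma markov_chain_survival:
  assumes chain: "markov_chain_from M S P x X" and x: "x \<in> S" and S: "countable S"
    and k: "\<And>a b. a \<in> S \<Longrightarrow> b \<in> S \<Longrightarrow> pmf (k a) b = P a b" "\<And>a. a \<in> S \<Longrightarrow> set_pmf (k a) \<subseteq> S"
  shows "emeasure M {\<omega> \<in> space M. \<forall>s\<le>t. X s \<omega> \<noteq> z} = survival k z t x"
proof -
  interpret prob_space M using chain by (simp add: markov_chain_from_def)
  have X [measurable]: "X s \<in> measurable M (count_space S)" for s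
    using chain by (simp add: markov_chain_from_def)
  have X_in: "X s \<omega> \<in> S" if "\<omega> \<in> space M" for s \<omega>
    using measurable_space[OF X that] by simp
  have [measurable]: "{\<omega> \<in> space M. X s \<omega> = c} \<in> sets M" for s c
  proof -
    have "{\<omega> \<in> space M. X s \<omega> = c} = X s -` ({c} \<inter> S) \<inter> space M" using X_in by auto
    also have "\<dots> \<in> sets M" by (rule measurable_sets[OF X]) simp
    finally show ?thesis .
  qed
  define H where "H t h = {\<omega> \<in> space M. \<forall>s\<le>t. X s \<omega> = h s}" for t and h :: "nat \<Rightarrow> 'b"
  define N where "N t m = {\<omega> \<in> space M. \<forall>s. t < s \<and> s \<le> t + m \<longrightarrow> X s \<omega> \<noteq> z}" for t m :: nat
  have H_sets [measurable]: "H t h \<in> sets M" for t h unfolding H_def by measurable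
  have N_sets [measurable]: "N t m \<in> sets M" for t m unfolding N_def by measurable
  have H_Suc: "emeasure M (H (Suc t) (h(Suc t := y))) = emeasure M (H t h) * ennreal (P (h t) y)"
    if y: "y \<in> S" and ht: "h t \<in> S" for t h y
  proof -
    have eq: "H (Suc t) (h(Suc t := y)) = {\<omega> \<in> space M. X (Suc t) \<omega> = y \<and> (\<forall>s\<le>t. X s \<omega> = h s)}"
      by (auto simp: H_def le_Suc_eq)
    have sub: "H (Suc t) (h(Suc t := y)) \<subseteq> H t h" unfolding eq H_def by auto
    have "measure M (H (Suc t) (h(Suc t := y))) = measure M (H t h) * P (h t) y"
    proof (cases "measure M (H t h) = 0")
      case True
      then show ?thesis
        using finite_measure_mono[OF sub] by (simp add: measure_le_0_iff)
    next
      case False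
      then have "\<P>(\<omega> in M. X (Suc t) \<omega> = y \<bar> \<forall>s\<le>t. X s \<omega> = h s) = P (h t) y"
        using chain y by (simp add: markov_chain_from_def H_def)
      with False show ?thesis by (simp add: cond_prob_def eq[symmetric] H_def[symmetric] field_simps)
    qed
    moreover have "P (h t) y \<ge> 0" using k(1)[OF ht y] by (metis pmf_nonneg)
    ultimately show ?thesis by (simp add: emeasure_eq_measure ennreal_mult)
  qed
  \<comment> \<open>The probability of avoiding \<open>z\<close> at the times \<open>1, \<dots>, m\<close>; in contrast to \<open>survival\<close>, time \<open>0\<close> is free.\<close>
  define w where "w m a = (case m of 0 \<Rightarrow> 1 | Suc m \<Rightarrow> \<integral>\<^sup>+b. survival k z m b \<partial>k a)" for m a
  have w: "survival k z m a = (if a = z then 0 else w m a)" for m a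
    by (cases m) (simp_all add: w_def survival_step)
  have avoid: "emeasure M (H t h \<inter> N t m) = emeasure M (H t h) * w m (h t)" if "h t \<in> S" for t h m
    using that
  proof (induction m arbitrary: t h)
    case 0
    have "H t h \<inter> N t 0 = H t h" by (auto simp: H_def N_def)
    then show ?case by (simp add: w_def)
  next
    case (Suc m)
    let ?h = "\<lambda>y. h(Suc t := y)"
    have "H t h \<inter> N t (Suc m) = (\<Union>y\<in>S - {z}. H (Suc t) (?h y) \<inter> N (Suc t) m)"
    proof (intro equalityI subsetI)
      fix \<omega> assume "\<omega> \<in> H t h \<inter> N t (Suc m)"
      then show "\<omega> \<in> (\<Union>y\<in>S - {z}. H (Suc t) (?h y) \<inter> N (Suc t) m)"
        using X_in[of \<omega> "Suc t"] by (auto simp: H_def N_def le_Suc_eq intro!: bexI[of _ "X (Suc t) \<omega>"])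
    next
      fix \<omega> assume "\<omega> \<in> (\<Union>y\<in>S - {z}. H (Suc t) (?h y) \<inter> N (Suc t) m)"
      then obtain y where y: "y \<noteq> z" and \<omega>: "\<omega> \<in> H (Suc t) (?h y)" "\<omega> \<in> N (Suc t) m" by auto
      have "X s \<omega> \<noteq> z" if "t < s" "s \<le> t + Suc m" for s
        using that \<omega> y by (cases "s = Suc t") (auto simp: H_def N_def)
      moreover have "X s \<omega> = h s" if "s \<le> t" for s
      proof -
        have "X s \<omega> = (?h y) s" using that \<omega>(1) unfolding H_def by simp
        with that show ?thesis by simp
      qed
      ultimately show "\<omega> \<in> H t h \<inter> N t (Suc m)"
        using \<omega>(1) by (auto simp: H_def N_def)
    qed
    then have "emeasure M (H t h \<inter> N t (Suc m))
        = (\<integral>\<^sup>+y. emeasure M (H (Suc t) (?h y) \<inter> N (Suc t) m) \<partial>count_space (S - {z}))"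
      using S by (simp only:) (intro emeasure_UN_countable,
          auto simp: disjoint_family_on_def H_def)
    also have "\<dots> = (\<integral>\<^sup>+y. emeasure M (H t h) * (pmf (k (h t)) y * survival k z m y) \<partial>count_space (S - {z}))"
    proof (intro nn_integral_cong)
      fix y assume "y \<in> space (count_space (S - {z}))"
      then have y: "y \<in> S" "y \<noteq> z" by auto
      have "emeasure M (H (Suc t) (?h y) \<inter> N (Suc t) m) = emeasure M (H (Suc t) (?h y)) * w m y"
        using Suc.IH[of "?h y" "Suc t"] y by (simp only: fun_upd_same)
      also have "\<dots> = emeasure M (H t h) * (pmf (k (h t)) y * survival k z m y)"
        using H_Suc[of y h t, OF y(1) Suc.prems] y by (simp only: w k(1)[OF Suc.prems y(1)] mult.assoc if_False)
      finally show "emeasure M (H (Suc t) (?h y) \<inter> N (Suc t) m)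
          = emeasure M (H t h) * (pmf (k (h t)) y * survival k z m y)" .
    qed
    also have "\<dots> = (\<integral>\<^sup>+y. emeasure M (H t h) * (pmf (k (h t)) y * survival k z m y) \<partial>count_space UNIV)"
      using k(2)[OF Suc.prems] by (intro nn_integral_count_space_eq) (auto simp: pmf_eq_0_set_pmf)
    also have "\<dots> = emeasure M (H t h) * w (Suc m) (h t)"
      by (simp add: nn_integral_cmult w_def nn_integral_measure_pmf)
    finally show ?case .
  qed
  have start: "AE \<omega> in M. X 0 \<omega> = x" using chain by (simp add: markov_chain_from_def)
  have "emeasure M {\<omega> \<in> space M. \<forall>s\<le>t. X s \<omega> \<noteq> z} = (if x = z then 0 else emeasure M (H 0 (\<lambda>_. x) \<inter> N 0 t))"
  proof (cases "x = z")
    case True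
    have "emeasure M {\<omega> \<in> space M. \<forall>s\<le>t. X s \<omega> \<noteq> z} = emeasure M {}"
    proof (rule emeasure_eq_AE)
      show "AE \<omega> in M. \<omega> \<in> {\<omega> \<in> space M. \<forall>s\<le>t. X s \<omega> \<noteq> z} \<longleftrightarrow> \<omega> \<in> {}"
        using start by eventually_elim (use True in blast)
    qed measurable
    with True show ?thesis by simp
  next
    case False
    have "emeasure M {\<omega> \<in> space M. \<forall>s\<le>t. X s \<omega> \<noteq> z} = emeasure M (H 0 (\<lambda>_. x) \<inter> N 0 t)"
    proof (rule emeasure_eq_AE)
      show "AE \<omega> in M. \<omega> \<in> {\<omega> \<in> space M. \<forall>s\<le>t. X s \<omega> \<noteq> z} \<longleftrightarrow> \<omega> \<in> H 0 (\<lambda>_. x) \<inter> N 0 t"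
        using start
      proof eventually_elim
        case (elim \<omega>)
        have "(\<forall>s\<le>t. X s \<omega> \<noteq> z) \<longleftrightarrow> (\<forall>s. 0 < s \<and> s \<le> t \<longrightarrow> X s \<omega> \<noteq> z)"
        proof (intro iffI allI impI)
          fix s assume "\<forall>s. 0 < s \<and> s \<le> t \<longrightarrow> X s \<omega> \<noteq> z" "s \<le> t"
          then show "X s \<omega> \<noteq> z" using elim False by (cases "s = 0") auto
        qed auto
        with elim show ?case by (auto simp: H_def N_def)
      qed
    qed measurable
    with False show ?thesis by simp
  qed
  moreover have "emeasure M (H 0 (\<lambda>_. x)) = 1"
  proof (rule emeasure_eq_1_AE)
    show "AE \<omega> in M. \<omega> \<in> H 0 (\<lambda>_. x)"
      using start AE_space by eventually_elim (simp add: H_def)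
  qed measurable
  ultimately show ?thesis
    using avoid[of "\<lambda>_. x" 0 t] x w[of t x] by simp
qed

text \<open>
  A hitting time \<open>n\<close> is \<open>\<Sum>t<n. 1\<close>, and its square is \<open>\<Sum>t<n. 2 t + 1\<close>. Both identities persist for the value
  \<open>\<infinity>\<close>, which makes the moment formulas below valid without any recurrence assumption.
\<close>
lemma hitting_time_moments_pointwise:
  fixes X :: "nat \<Rightarrow> 'w \<Rightarrow> 'v" and z :: 'v
  defines "I \<equiv> \<lambda>\<omega> t. (if \<forall>s\<le>t. X s \<omega> \<noteq> z then 1 else 0 :: ennreal)"
  shows "hitting_time X z \<omega> = (\<Sum>t. I \<omega> t)"
    and "(hitting_time X z \<omega>)\<^sup>2 = (\<Sum>t. of_nat (2 * t + 1) * I \<omega> t)"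
proof -
  have "hitting_time X z \<omega> = (\<Sum>t. I \<omega> t) \<and>
      (hitting_time X z \<omega>)\<^sup>2 = (\<Sum>t. of_nat (2 * t + 1) * I \<omega> t)"
  proof (cases "\<exists>n. X n \<omega> = z")
    case True
    define n where "n = (LEAST n. X n \<omega> = z)"
    have n: "X n \<omega> = z" "\<And>m. X m \<omega> = z \<Longrightarrow> n \<le> m"
      using True unfolding n_def by (auto intro: LeastI_ex Least_le)
    have T: "hitting_time X z \<omega> = of_nat n"
      unfolding hitting_time_def using n by (intro antisym INF_lower INF_greatest) auto
    have I: "I \<omega> t = (if t < n then 1 else 0)" for t
    proof -
      have "(\<forall>s\<le>t. X s \<omega> \<noteq> z) \<longleftrightarrow> t < n"
      proof
        show "t < n" if "\<forall>s\<le>t. X s \<omega> \<noteq> z" using that n(1) not_le by blast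
        show "\<forall>s\<le>t. X s \<omega> \<noteq> z" if "t < n"
        proof (intro allI impI notI)
          fix s assume "s \<le> t" "X s \<omega> = z"
          then show False using n(2)[of s] that by simp
        qed
      qed
      then show ?thesis by (simp add: I_def)
    qed
    have "(\<Sum>t. I \<omega> t) = (\<Sum>t<n. I \<omega> t)" "(\<Sum>t. of_nat (2 * t + 1) * I \<omega> t)
        = (\<Sum>t<n. of_nat (2 * t + 1) * I \<omega> t)"
      by (rule suminf_finite; simp add: I)+
    moreover have "(\<Sum>t<n. 2 * t + 1) = n\<^sup>2" by (induction n) (auto simp: power2_eq_square)
    then have "(\<Sum>t<n. of_nat (2 * t + 1)) = (of_nat n :: ennreal)\<^sup>2"
      by (simp only: of_nat_sum[symmetric] of_nat_power[symmetric])
    ultimately show ?thesis by (simp add: T I del: of_nat_add of_nat_mult of_nat_Suc)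
  next
    case False
    have top: "(\<Sum>t. f t) = top" if "\<And>t. f t \<ge> 1" for f :: "nat \<Rightarrow> ennreal"
    proof -
      have "of_nat n \<le> (\<Sum>t. f t)" for n
      proof -
        have "of_nat n = (\<Sum>t<n. 1 :: ennreal)" by simp
        also have "\<dots> \<le> (\<Sum>t<n. f t)" by (intro sum_mono that)
        also have "\<dots> \<le> (\<Sum>t. f t)" by (rule sum_le_suminf) auto
        finally show ?thesis .
      qed
      then have "(SUP n. of_nat n :: ennreal) \<le> (\<Sum>t. f t)" by (intro SUP_least)
      then show ?thesis by (simp add: ennreal_SUP_of_nat_eq_top top_unique)
    qed
    have "I \<omega> t = 1" for t using False by (simp add: I_def)
    moreover have "(1 :: ennreal) \<le> of_nat (2 * t + 1)" for t by (simp add: of_nat_Suc)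
    moreover have "hitting_time X z \<omega> = top" using False by (simp add: hitting_time_def)
    ultimately show ?thesis by (simp add: top ennreal_top_mult power2_eq_square del: of_nat_add)
  qed
  then show "hitting_time X z \<omega> = (\<Sum>t. I \<omega> t)"
    "(hitting_time X z \<omega>)\<^sup>2 = (\<Sum>t. of_nat (2 * t + 1) * I \<omega> t)" by auto
qed

lemma markov_chain_hitting_time:
  assumes chain: "markov_chain_from M S P x X" and x: "x \<in> S" and S: "countable S"
    and k: "\<And>a b. a \<in> S \<Longrightarrow> b \<in> S \<Longrightarrow> pmf (k a) b = P a b" "\<And>a. a \<in> S \<Longrightarrow> set_pmf (k a) \<subseteq> S"
  shows "hitting_time X z \<in> borel_measurable M"
    and "(\<integral>\<^sup>+\<omega>. hitting_time X z \<omega> \<partial>M) = mean_hit k z x"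
    and "(\<integral>\<^sup>+\<omega>. (hitting_time X z \<omega>)\<^sup>2 \<partial>M) = sq_hit k z x"
proof -
  have X: "X s \<in> measurable M (count_space S)" for s
    using chain by (simp add: markov_chain_from_def)
  have [measurable]: "{\<omega> \<in> space M. X s \<omega> \<noteq> z} \<in> sets M" for s
  proof -
    have "{\<omega> \<in> space M. X s \<omega> \<noteq> z} = X s -` (S - {z}) \<inter> space M"
      using measurable_space[OF X] by auto
    also have "\<dots> \<in> sets M" by (rule measurable_sets[OF X]) simp
    finally show ?thesis .
  qed
  let ?I = "\<lambda>t \<omega>. (if \<forall>s\<le>t. X s \<omega> \<noteq> z then 1 else 0 :: ennreal)"
  have [measurable]: "?I t \<in> borel_measurable M" for t by measurable
  have I: "(\<integral>\<^sup>+\<omega>. ?I t \<omega> \<partial>M) = survival k z t x" for t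
  proof -
    have "(\<integral>\<^sup>+\<omega>. ?I t \<omega> \<partial>M) = (\<integral>\<^sup>+\<omega>. indicator {\<omega> \<in> space M. \<forall>s\<le>t. X s \<omega> \<noteq> z} \<omega> \<partial>M)"
      by (intro nn_integral_cong) (auto simp: indicator_def)
    also have "\<dots> = emeasure M {\<omega> \<in> space M. \<forall>s\<le>t. X s \<omega> \<noteq> z}"
      by (rule nn_integral_indicator) measurable
    finally show ?thesis by (simp add: markov_chain_survival[OF assms])
  qed
  show "hitting_time X z \<in> borel_measurable M"
    unfolding hitting_time_moments_pointwise(1)[abs_def] by measurable
  show "(\<integral>\<^sup>+\<omega>. hitting_time X z \<omega> \<partial>M) = mean_hit k z x"
    by (simp add: hitting_time_moments_pointwise(1) nn_integral_suminf I mean_hit_def)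
  show "(\<integral>\<^sup>+\<omega>. (hitting_time X z \<omega>)\<^sup>2 \<partial>M) = sq_hit k z x"
    by (simp add: hitting_time_moments_pointwise(2) nn_integral_suminf nn_integral_cmult I sq_hit_def
        del: of_nat_add of_nat_mult of_nat_Suc)
qed

section \<open>Variance and deviation of variables with mean one\<close>

text \<open>
  Moving \<open>2 u\<close> to the left makes the binomial formula true for \<open>u = \<infinity>\<close> as well, so no separate treatment of
  infinite values is needed when it is integrated.
\<close>
lemma square_deviation_from_one:
  "e2ennreal ((enn2ereal u - 1)\<^sup>2) + 2 * u = u\<^sup>2 + 1"
proof (cases u)
  case (real s)
  have "ennreal ((s - 1)\<^sup>2) + 2 * ennreal s = ennreal ((s - 1)\<^sup>2 + 2 * s)"
    using real by (simp add: ennreal_mult')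
  also have "(s - 1)\<^sup>2 + 2 * s = s\<^sup>2 + 1" by (simp add: power2_eq_square algebra_simps)
  also have "ennreal (s\<^sup>2 + 1) = (ennreal s)\<^sup>2 + 1" using real by (simp add: ennreal_power)
  also have "ennreal ((s - 1)\<^sup>2) = e2ennreal ((enn2ereal u - 1)\<^sup>2)"
    using real by (simp add: enn2ereal_ennreal one_ereal_def)
  finally show ?thesis using real by simp
next
  case top
  then show ?thesis by (simp add: power2_eq_square top_ereal_def[symmetric])
qed

lemma nn_variance_mean_one:
  assumes "prob_space M" "U \<in> borel_measurable M" "(\<integral>\<^sup>+\<omega>. U \<omega> \<partial>M) = 1"
  shows "nn_variance M U + 1 = (\<integral>\<^sup>+\<omega>. (U \<omega>)\<^sup>2 \<partial>M)"
proof -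
  interpret prob_space M by fact
  note [measurable] = assms(2)
  have [measurable]: "(\<lambda>\<omega>. e2ennreal ((enn2ereal (U \<omega>) - 1)\<^sup>2)) \<in> borel_measurable M"
    unfolding power2_eq_square by measurable
  have "nn_variance M U + 2 = (\<integral>\<^sup>+\<omega>. e2ennreal ((enn2ereal (U \<omega>) - 1)\<^sup>2) + 2 * U \<omega> \<partial>M)"
    unfolding nn_variance_def assms(3)
    by (subst nn_integral_add) (simp_all add: nn_integral_cmult assms(3) one_ennreal.rep_eq)
  also have "\<dots> = (\<integral>\<^sup>+\<omega>. (U \<omega>)\<^sup>2 \<partial>M) + 1"
    by (simp add: square_deviation_from_one nn_integral_add emeasure_space_1)
  finally have "1 + (nn_variance M U + 1) = 1 + (\<integral>\<^sup>+\<omega>. (U \<omega>)\<^sup>2 \<partial>M)"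
    by (simp add: ac_simps flip: one_add_one)
  then show ?thesis by (subst (asm) ennreal_add_left_cancel) simp
qed

lemma chebyshev_nn_variance:
  assumes "prob_space M" "U \<in> borel_measurable M" "(\<integral>\<^sup>+\<omega>. U \<omega> \<partial>M) = 1" and e: "e > 0"
  shows "ennreal (\<P>(\<omega> in M. \<bar>enn2ereal (U \<omega>) - ereal 1\<bar> > ereal e)) \<le> ennreal (1 / e\<^sup>2) * nn_variance M U"
proof -
  interpret prob_space M by fact
  note [measurable] = assms(2)
  let ?f = "\<lambda>\<omega>. e2ennreal ((enn2ereal (U \<omega>) - 1)\<^sup>2)"
  have [measurable]: "?f \<in> borel_measurable M"
    unfolding power2_eq_square by measurable
  have sub: "{\<omega> \<in> space M. \<bar>enn2ereal (U \<omega>) - ereal 1\<bar> > ereal e}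
      \<subseteq> {\<omega> \<in> space M. 1 \<le> ennreal (1 / e\<^sup>2) * ?f \<omega>}"
  proof (intro subsetI)
    fix \<omega> assume *: "\<omega> \<in> {\<omega> \<in> space M. \<bar>enn2ereal (U \<omega>) - ereal 1\<bar> > ereal e}"
    have "1 \<le> ennreal (1 / e\<^sup>2) * ?f \<omega>"
    proof (cases "U \<omega>")
      case (real s)
      with * have "e < \<bar>s - 1\<bar>" by (simp add: enn2ereal_ennreal)
      then have "e\<^sup>2 \<le> (s - 1)\<^sup>2" using e by (metis abs_le_square_iff abs_of_pos less_imp_le)
      then have "1 \<le> 1 / e\<^sup>2 * (s - 1)\<^sup>2" using e by (simp add: field_simps)
      then show ?thesis
        using real by (simp add: enn2ereal_ennreal one_ereal_def flip: ennreal_mult'')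
    next
      case top
      then show ?thesis using e
        by (simp add: power2_eq_square top_ereal_def ennreal_mult_top)
    qed
    with * show "\<omega> \<in> {\<omega> \<in> space M. 1 \<le> ennreal (1 / e\<^sup>2) * ?f \<omega>}" by simp
  qed
  have "ennreal (\<P>(\<omega> in M. \<bar>enn2ereal (U \<omega>) - ereal 1\<bar> > ereal e))
      \<le> emeasure M {\<omega> \<in> space M. 1 \<le> ennreal (1 / e\<^sup>2) * ?f \<omega>}"
    unfolding emeasure_eq_measure[symmetric] by (intro emeasure_mono sub) measurable
  also have "\<dots> \<le> ennreal (1 / e\<^sup>2) * (\<integral>\<^sup>+\<omega>. ?f \<omega> * indicator (space M) \<omega> \<partial>M)"
    using nn_integral_Markov_inequality[of ?f "space M" M "ennreal (1 / e\<^sup>2)"]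
    by (simp add: Int_def conj_commute)
  also have "(\<integral>\<^sup>+\<omega>. ?f \<omega> * indicator (space M) \<omega> \<partial>M) = nn_variance M U"
    unfolding nn_variance_def assms(3)
    by (intro nn_integral_cong) (simp add: one_ennreal.rep_eq)
  finally show ?thesis .
qed

section \<open>Birth and death chains on a rooted tree\<close>

lemma pmf_mult_le_nn_integral:
  fixes f :: "'a \<Rightarrow> ennreal"
  shows "pmf q x * f x \<le> (\<integral>\<^sup>+y. f y \<partial>measure_pmf q)"
  unfolding nn_integral_measure_pmf
  using nn_integral_ge_point[of x UNIV "\<lambda>y. ennreal (pmf q y) * f y"] by simp

lemma nn_integral_count_space_has_sum:
  fixes f :: "'a \<Rightarrow> real"
  assumes "(f has_sum s) A" "\<And>x. x \<in> A \<Longrightarrow> f x \<ge> 0"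
  shows "(\<integral>\<^sup>+x. ennreal (f x) \<partial>count_space A) = ennreal s"
proof -
  have "f summable_on A" using assms(1) by (auto simp: summable_on_def)
  then have "(\<lambda>x. norm (f x)) summable_on A"
    using assms(2) by (subst summable_on_cong[of A _ f]) auto
  then have "Infinite_Set_Sum.abs_summable_on f A"
    by (rule abs_summable_equivalent[THEN iffD1])
  then have int: "integrable (count_space A) f"
    by (simp add: Infinite_Set_Sum.abs_summable_on_def)
  have "(\<integral>\<^sup>+x. ennreal (f x) \<partial>count_space A) = ennreal (\<integral>x. f x \<partial>count_space A)"
    using assms(2) by (intro nn_integral_eq_integral[OF int]) (auto simp: AE_count_space)
  also have "(\<integral>x. f x \<partial>count_space A) = s"
    using infsetsum_infsum[OF \<open>Infinite_Set_Sum.abs_summable_on f A\<close>] infsumI[OF assms(1)]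
    by (simp add: infsetsum_def)
  finally show ?thesis .
qed

locale birth_death_tree =
  fixes G :: "'v pair_pre_digraph" and r :: 'v and P :: "'v \<Rightarrow> 'v \<Rightarrow> real"
  assumes tree: "rooted_tree G r" and bd: "birth_death G r P"
begin

abbreviation V where "V \<equiv> pverts G"
abbreviation p where "p \<equiv> parent G r"

lemma root_in: "r \<in> V"
  using tree by (simp add: rooted_tree_def)

lemma parent_in: "x \<in> V \<Longrightarrow> x \<noteq> r \<Longrightarrow> p x \<in> V"
  using parent_root_path(1)[OF tree] by blast

lemma rates_pos:
  assumes "x \<in> V" "x \<noteq> r"
  shows "P (p x) x > 0" "P x (p x) > 0"
  using bd assms by (auto simp: birth_death_def)

lemma P_zero:
  assumes "x \<in> V" "y \<in> V" "x \<noteq> y" "x \<noteq> r \<Longrightarrow> y \<noteq> p x" "y \<noteq> r \<Longrightarrow> x \<noteq> p y"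
  shows "P x y = 0"
  using bd assms unfolding birth_death_def by blast

lemma P_nonneg:
  assumes "x \<in> V" "y \<in> V"
  shows "P x y \<ge> 0"
proof (cases "x = y")
  case True
  then show ?thesis using bd assms by (simp add: birth_death_def)
next
  case False
  then consider "x \<noteq> r" "y = p x" | "y \<noteq> r" "x = p y" | "P x y = 0"
    using P_zero[OF assms] by blast
  then show ?thesis
    using rates_pos(2)[OF assms(1)] rates_pos(1)[OF assms(2)] by cases auto
qed

text \<open>
  The transition matrix is specified on the vertex set only; extending it by zero gives probability
  distributions on the whole type. Rows that do not belong to vertices have no meaning.
\<close>
definition kernel :: "'v \<Rightarrow> 'v pmf" where
  "kernel x = embed_pmf (\<lambda>y. if y \<in> V then P x y else 0)"

lemma pmf_kernel:
  assumes "x \<in> V"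
  shows "pmf (kernel x) y = (if y \<in> V then P x y else 0)"
  unfolding kernel_def
proof (rule pmf_embed_pmf)
  show "0 \<le> (if y \<in> V then P x y else 0)" for y using P_nonneg assms by auto
  have "(\<integral>\<^sup>+y. ennreal (if y \<in> V then P x y else 0) \<partial>count_space UNIV)
      = (\<integral>\<^sup>+y. ennreal (if y \<in> V then P x y else 0) \<partial>count_space V)"
    by (rule nn_integral_count_space_eq) auto
  also have "\<dots> = (\<integral>\<^sup>+y. ennreal (P x y) \<partial>count_space V)" by (intro nn_integral_cong) auto
  also have "\<dots> = ennreal 1"
    using bd assms P_nonneg by (intro nn_integral_count_space_has_sum) (auto simp: birth_death_def)
  finally show "(\<integral>\<^sup>+y. ennreal (if y \<in> V then P x y else 0) \<partial>count_space UNIV) = 1" by simp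
qed

lemma set_kernel:
  assumes "x \<in> V" "y \<in> set_pmf (kernel x)"
  shows "y \<in> V" "y = x \<or> (x \<noteq> r \<and> y = p x) \<or> (y \<noteq> r \<and> p y = x)"
proof -
  have "pmf (kernel x) y \<noteq> 0" using assms(2) by (simp add: set_pmf_iff)
  then show "y \<in> V" "y = x \<or> (x \<noteq> r \<and> y = p x) \<or> (y \<noteq> r \<and> p y = x)"
    using pmf_kernel[OF assms(1), of y] P_zero[OF assms(1), of y] by (auto split: if_splits)
qed

text \<open>The invariant measure, normalized to the value \<open>1\<close> at the root.\<close>
definition weight :: "'v \<Rightarrow> real" where
  "weight x = (\<Prod>y \<in> nonroot_path G r x. P (p y) y / P y (p y))"

lemma weight_root: "weight r = 1"
  by (simp add: weight_def nonroot_path_root[OF tree])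

lemma finite_nonroot_path: "finite (nonroot_path G r x)"
  by (simp add: nonroot_path_def)

lemma weight_parent:
  assumes "x \<in> V" "x \<noteq> r"
  shows "weight x * P x (p x) = weight (p x) * P (p x) x"
  using rates_pos[OF assms]
  by (simp add: weight_def nonroot_path_parent[OF tree assms] finite_nonroot_path
      not_in_nonroot_path_parent[OF tree assms])

lemma weight_pos:
  assumes "x \<in> V"
  shows "weight x > 0"
  unfolding weight_def
proof (rule prod_pos)
  fix y assume "y \<in> nonroot_path G r x"
  then have "y \<in> V" "y \<noteq> r" using nonroot_path_subset[OF tree assms] by auto
  then show "0 < P (p y) y / P y (p y)" using rates_pos by simp
qed

lemma detailed_balance:
  assumes "x \<in> V" "y \<in> V"
  shows "weight x * P x y = weight y * P y x"
proof -
  consider "x = y" | "x \<noteq> r" "y = p x" | "y \<noteq> r" "x = p y"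
    | "x \<noteq> y" "\<not> (x \<noteq> r \<and> y = p x)" "\<not> (y \<noteq> r \<and> x = p y)" by blast
  then show ?thesis
    using weight_parent[of x] weight_parent[of y] assms P_zero[of x y] P_zero[of y x]
    by cases auto
qed

lemma weight_summable: "weight summable_on V"
proof (cases "finite V")
  case False
  then show ?thesis using bd unfolding birth_death_def weight_def[abs_def] by blast
qed simp

text \<open>A convergent sum of positive weights has only countably many terms.\<close>
lemma countable_vertices: "countable V"
proof -
  have "countable {x \<in> V. weight x \<noteq> 0}" by (rule summable_countable_real[OF weight_summable])
  also have "{x \<in> V. weight x \<noteq> 0} = V" using weight_pos by force
  finally show ?thesis .
qed

lemma mean_return_finite: "(\<integral>\<^sup>+y. mean_hit kernel r y \<partial>kernel r) < \<infinity>"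
proof -
  define w where "w x = (if x \<in> V then ennreal (weight x) else 0)" for x
  have "(\<integral>\<^sup>+x. w x * pmf (kernel x) y \<partial>count_space UNIV) = w y" for y
  proof -
    have "w x * ennreal (pmf (kernel x) y) = w y * ennreal (pmf (kernel y) x)" for x
      using detailed_balance[of x y] weight_pos[of x] weight_pos[of y]
      by (auto simp: w_def pmf_kernel P_nonneg less_imp_le ennreal_mult'[symmetric])
    then have "(\<integral>\<^sup>+x. w x * pmf (kernel x) y \<partial>count_space UNIV)
        = w y * (\<integral>\<^sup>+x. pmf (kernel y) x \<partial>count_space UNIV)"
      by (simp add: nn_integral_cmult)
    then show ?thesis by (simp add: nn_integral_pmf_eq_1)
  qed
  then have "w r * (\<integral>\<^sup>+y. mean_hit kernel r y \<partial>kernel r) \<le> (\<integral>\<^sup>+x. w x \<partial>count_space UNIV)"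
    by (rule kac_inequality)
  also have "\<dots> = (\<integral>\<^sup>+x. w x \<partial>count_space V)"
    by (rule nn_integral_count_space_eq) (auto simp: w_def)
  also have "\<dots> = (\<integral>\<^sup>+x. ennreal (weight x) \<partial>count_space V)"
    by (intro nn_integral_cong) (simp add: w_def)
  also have "\<dots> = ennreal (infsum weight V)"
    using weight_summable weight_pos
    by (intro nn_integral_count_space_has_sum) (auto simp: less_imp_le)
  finally show ?thesis
    by (simp add: w_def root_in weight_root order.strict_trans1)
qed

text \<open>
  The parent of \<open>x\<close> moves to \<open>x\<close> with positive probability, so an infinite mean time from \<open>x\<close> would give the
  parent an infinite mean time as well, or, if the parent is the root, an infinite mean return time.
\<close>
lemma mean_hit_root_finite:
  assumes "x \<in> V"
  shows "mean_hit kernel r x < \<infinity>"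
  using assms
proof (induction x rule: rooted_tree_induct[OF tree, consumes 1, case_names root parent])
  case root
  then show ?case by simp
next
  case (parent x)
  have "(\<integral>\<^sup>+y. mean_hit kernel r y \<partial>kernel (p x)) < \<infinity>"
  proof (cases "p x = r")
    case True
    then show ?thesis using mean_return_finite by simp
  next
    case False
    then show ?thesis using parent.IH mean_hit_step[OF False] by (simp add: ennreal_add_less_top)
  qed
  then have "ennreal (pmf (kernel (p x)) x) * mean_hit kernel r x < \<infinity>"
    by (rule order.strict_trans1[OF pmf_mult_le_nn_integral])
  moreover have "pmf (kernel (p x)) x > 0"
    using parent.hyps rates_pos parent_in by (simp add: pmf_kernel)
  ultimately show ?case by (auto simp: ennreal_mult_less_top)
qed

text \<open>
  A chain started at \<open>x\<close> visits the parent before the root. In the induction, one step from \<open>x\<close> leads to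
  vertices from which avoiding the root is, by hypothesis, at least as likely as from the parent.
\<close>
lemma survival_parent_le:
  assumes "x \<in> V" "x \<noteq> r"
  shows "survival kernel r t (p x) \<le> survival kernel r t x"
  using assms
proof (induction t arbitrary: x)
  case (Suc t)
  have "survival kernel r (Suc t) (p x) \<le> survival kernel r t (p x)" by (rule survival_decreasing)
  also have "\<dots> = (\<integral>\<^sup>+y. survival kernel r t (p x) \<partial>kernel x)" by simp
  also have "\<dots> \<le> (\<integral>\<^sup>+y. survival kernel r t y \<partial>kernel x)"
  proof (intro nn_integral_mono_AE AE_pmfI)
    fix y assume y: "y \<in> set_pmf (kernel x)"
    from set_kernel[OF Suc.prems(1) y]
    consider "y = x" | "y = p x" | "y \<in> V" "y \<noteq> r" "p y = x" by blast
    then show "survival kernel r t (p x) \<le> survival kernel r t y"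
      using Suc.IH[of x] Suc.IH[of y] Suc.prems by cases (auto intro: order_trans)
  qed
  finally show ?case using Suc.prems by (simp add: survival_step)
qed simp

lemma mean_hit_parent_le:
  assumes "x \<in> V" "x \<noteq> r"
  shows "mean_hit kernel r (p x) \<le> mean_hit kernel r x"
  unfolding mean_hit_def by (intro suminf_le survival_parent_le assms) auto

text \<open>
  Every increment of \<open>h\<close> in one step is nonnegative, with the exception of the one towards the parent,
  and the mean increment is \<open>- 1\<close>. So the mean of the absolute increment is \<open>2 \<mu>\<^sub>x m\<^sub>x - 1\<close>, where \<open>\<mu>\<^sub>x m\<^sub>x\<close> is at most
  \<open>K\<close>; multiplied with the bound \<open>K / c\<close> for a single increment, this bounds the second moment.
\<close>
lemma increment_variance:
  fixes K c :: real
  defines "h \<equiv> \<lambda>x. enn2real (mean_hit kernel r x)"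
  assumes D: "D \<subseteq> V - {r}" "\<And>x. x \<in> V \<Longrightarrow> x \<noteq> r \<Longrightarrow> p x \<in> D \<Longrightarrow> x \<in> D"
    and c: "c > 0" "\<And>x. x \<in> D \<Longrightarrow> c \<le> P x (p x)"
    and K: "K \<ge> 0" "\<And>x. x \<in> D \<Longrightarrow> ennreal (P x (p x)) * mean_hit kernel (p x) x \<le> ennreal K"
    and x: "x \<in> D"
  shows "integrable (kernel x) (\<lambda>y. (h y - h x)\<^sup>2)"
    and "measure_pmf.expectation (kernel x) (\<lambda>y. (h y - h x)\<^sup>2) \<le> 2 * K\<^sup>2 / c"
proof -
  have incr: "0 \<le> h y - h (p y)" "P y (p y) * (h y - h (p y)) \<le> K" "h y - h (p y) \<le> K / c"
    if "y \<in> D" for y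
  proof -
    note yD = that
    have y: "y \<in> V" "y \<noteq> r" using that D(1) by auto
    note py = parent_in[OF y]
    note fin = mean_hit_root_finite[OF y(1)] mean_hit_root_finite[OF py]
    have eq: "mean_hit kernel r y = ennreal (h y)" "mean_hit kernel r (p y) = ennreal (h (p y))"
      using fin by (simp_all add: h_def)
    have h0: "h x \<ge> 0" for x by (simp add: h_def)
    show le: "0 \<le> h y - h (p y)"
      using mean_hit_parent_le[OF y] unfolding eq by (simp add: h0)
    have "ennreal (h y) \<le> mean_hit kernel (p y) y + ennreal (h (p y))"
      using mean_hit_triangle[of kernel r y "p y"] unfolding eq .
    moreover obtain m where m: "mean_hit kernel (p y) y = ennreal m" "m \<ge> 0"
    proof -
      assume m: "\<And>m. mean_hit kernel (p y) y = ennreal m \<Longrightarrow> 0 \<le> m \<Longrightarrow> thesis"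
      have "mean_hit kernel (p y) y \<noteq> top"
        using K(2)[OF yD] rates_pos(2)[OF y]
        by (metis ennreal_eq_0_iff ennreal_less_top ennreal_mult_eq_top_iff linorder_not_le top.not_eq_extremum)
      then show ?thesis using m by (cases "mean_hit kernel (p y) y") auto
    qed
    ultimately have "h y - h (p y) \<le> m" using h0 by (simp flip: ennreal_plus)
    moreover have "P y (p y) * m \<le> K"
      using K(2)[OF that] K(1) m rates_pos(2)[OF y] by (simp flip: ennreal_mult)
    ultimately show *: "P y (p y) * (h y - h (p y)) \<le> K"
      using rates_pos(2)[OF y] by (meson mult_left_mono order_trans less_imp_le)
    have "c * (h y - h (p y)) \<le> P y (p y) * (h y - h (p y))"
      by (rule mult_right_mono[OF c(2)[OF that] le])
    with * show "h y - h (p y) \<le> K / c" using c(1) by (simp add: field_simps)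
  qed
  have xV: "x \<in> V" "x \<noteq> r" using x D(1) by auto
  let ?e = "\<lambda>y. h y - h x"
  let ?m = "h x - h (p x)"
  have e_cases: "?e y = - ?m \<and> y = p x \<or> 0 \<le> ?e y \<and> ?e y \<le> K / c"
    if y: "y \<in> set_pmf (kernel x)" for y
  proof -
    from set_kernel[OF xV(1) y] consider "y = x" | "y = p x" | "y \<in> D" "p y = x"
      using D(2)[of y] x by blast
    then show ?thesis using incr[of y] K(1) c(1) by cases auto
  qed
  have abs_e: "\<bar>?e y\<bar> \<le> K / c" "\<bar>?e y\<bar> = ?e y + 2 * ?m * indicator {p x} y"
    if y: "y \<in> set_pmf (kernel x)" for y
  proof -
    show "\<bar>?e y\<bar> \<le> K / c" using e_cases[OF y] incr[OF x] by auto
    show "\<bar>?e y\<bar> = ?e y + 2 * ?m * indicator {p x} y"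
      using e_cases[OF y] incr(1)[OF x] by (auto simp: indicator_def)
  qed
  have Kc: "K / c \<ge> 0" using K(1) c(1) by simp
  have "(?e y)\<^sup>2 \<le> (K / c)\<^sup>2" if y: "y \<in> set_pmf (kernel x)" for y
    using power_mono[OF abs_e(1)[OF y], of 2] by simp
  then show int: "integrable (kernel x) (\<lambda>y. (?e y)\<^sup>2)"
    by (intro measure_pmf.integrable_const_bound[where B = "(K / c)\<^sup>2"] AE_pmfI) auto
  note step = mean_hit_real_step(1,2)[OF xV(2) mean_hit_root_finite[OF xV(1)], folded h_def]
  have int': "integrable (kernel x) ?e" "integrable (kernel x) (indicator {p x} :: 'v \<Rightarrow> real)"
    using step(1) by (auto simp: h_def measure_pmf.emeasure_eq_measure
        intro!: integrable_real_indicator)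
  have "measure_pmf.expectation (kernel x) (\<lambda>y. (?e y)\<^sup>2)
      \<le> measure_pmf.expectation (kernel x) (\<lambda>y. K / c * (?e y + 2 * ?m * indicator {p x} y))"
  proof (rule integral_mono_AE)
    show "AE y in kernel x. (?e y)\<^sup>2 \<le> K / c * (?e y + 2 * ?m * indicator {p x} y)"
    proof (rule AE_pmfI)
      fix y assume y: "y \<in> set_pmf (kernel x)"
      have "(?e y)\<^sup>2 = \<bar>?e y\<bar> * \<bar>?e y\<bar>" by (simp add: power2_eq_square)
      also have "\<dots> \<le> K / c * \<bar>?e y\<bar>" by (intro mult_right_mono abs_e(1)[OF y]) simp
      finally show "(?e y)\<^sup>2 \<le> K / c * (?e y + 2 * ?m * indicator {p x} y)"
        by (simp only: abs_e(2)[OF y])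
    qed
    show "integrable (kernel x) (\<lambda>y. K / c * (?e y + 2 * ?m * indicator {p x} y))"
      using int' by (intro integrable_mult_right Bochner_Integration.integrable_add)
  qed (rule int)
  also have "\<dots> = K / c * (measure_pmf.expectation (kernel x) ?e
      + 2 * ?m * measure_pmf.expectation (kernel x) (indicator {p x}))"
    using int' by simp
  also have "measure_pmf.expectation (kernel x) ?e = - 1"
    using step by (simp add: h_def)
  also have "measure_pmf.expectation (kernel x) (indicator {p x}) = P x (p x)"
    using pmf_kernel[OF xV(1), of "p x"] parent_in[OF xV] by (simp add: pmf.rep_eq)
  also have "K / c * (- 1 + 2 * ?m * P x (p x)) \<le> K / c * (2 * K)"
    using incr(2)[OF x] Kc by (intro mult_left_mono) (simp_all add: algebra_simps)
  finally show "measure_pmf.expectation (kernel x) (\<lambda>y. (?e y)\<^sup>2) \<le> 2 * K\<^sup>2 / c"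
    by (simp add: power2_eq_square mult.commute mult.left_commute)
qed

lemma sq_hit_root_le:
  fixes K c :: real
  assumes D: "D \<subseteq> V - {r}" "\<And>x. x \<in> V \<Longrightarrow> x \<noteq> r \<Longrightarrow> p x \<in> D \<Longrightarrow> x \<in> D"
    and up: "\<And>x. x \<in> D \<Longrightarrow> p x \<in> insert r D"
    and c: "c > 0" "\<And>x. x \<in> D \<Longrightarrow> c \<le> P x (p x)"
    and K: "K \<ge> 0" "\<And>x. x \<in> D \<Longrightarrow> ennreal (P x (p x)) * mean_hit kernel (p x) x \<le> ennreal K"
    and x: "x \<in> D"
  shows "sq_hit kernel r x \<le> ennreal ((enn2real (mean_hit kernel r x))\<^sup>2
           + 2 * K\<^sup>2 / c * enn2real (mean_hit kernel r x))"
proof (rule sq_hit_le[OF _ _ _ _ _ _ x])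
  show "set_pmf (kernel x) \<subseteq> insert r D" if "x \<in> D" for x
  proof
    fix y assume y: "y \<in> set_pmf (kernel x)"
    have "x \<in> V" using that D(1) by auto
    from set_kernel[OF this y] show "y \<in> insert r D" using D(2)[of y] up that by auto
  qed
  show "mean_hit kernel r x < \<infinity>" if "x \<in> D" for x
    using that D(1) by (intro mean_hit_root_finite) auto
  show "0 \<le> 2 * K\<^sup>2 / c" using c(1) by simp
qed (use D in \<open>auto intro!: increment_variance[OF D c K]\<close>)

end

context birth_death_tree
begin

text \<open>
  Also true for \<open>K = \<infinity>\<close>: the mean \<open>E\<close> is finite, so the right-hand side is infinite in this case.
\<close>
lemma hitting_time_variance:
  fixes M :: "'v \<Rightarrow> 'w measure" and X :: "'v \<Rightarrow> nat \<Rightarrow> 'w \<Rightarrow> 'v" and a :: 'v and c :: real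
  defines "B \<equiv> branch G r (top_vertex G r a)"
  defines "E \<equiv> \<integral>\<^sup>+\<omega>. hitting_time (X a) r \<omega> \<partial>M a"
  defines "K \<equiv> SUP b\<in>B. ennreal (P b (p b)) * (\<integral>\<^sup>+\<omega>. hitting_time (X b) (p b) \<omega> \<partial>M b)"
  assumes a: "a \<in> V" "a \<noteq> r"
    and chain: "\<And>x. x \<in> V \<Longrightarrow> markov_chain_from (M x) V P x (X x)"
    and c: "c > 0" "\<And>b. b \<in> B \<Longrightarrow> c \<le> P b (p b)"
  shows "(\<lambda>\<omega>. hitting_time (X a) r \<omega> / E) \<in> borel_measurable (M a)"
    and "(\<integral>\<^sup>+\<omega>. hitting_time (X a) r \<omega> / E \<partial>M a) = 1"
    and "nn_variance (M a) (\<lambda>\<omega>. hitting_time (X a) r \<omega> / E) \<le> ennreal (2 / c) * (K\<^sup>2 / E)"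
proof -
  have ht: "hitting_time (X x) z \<in> borel_measurable (M x)"
      "(\<integral>\<^sup>+\<omega>. hitting_time (X x) z \<omega> \<partial>M x) = mean_hit kernel z x"
      "(\<integral>\<^sup>+\<omega>. (hitting_time (X x) z \<omega>)\<^sup>2 \<partial>M x) = sq_hit kernel z x" if "x \<in> V" for x z
    using markov_chain_hitting_time[OF chain[OF that] that countable_vertices, of kernel z]
      set_kernel(1) by (auto simp: pmf_kernel)
  note [measurable] = ht(1)[OF a(1)]
  interpret prob_space "M a" using chain[OF a(1)] by (simp add: markov_chain_from_def)
  define e where "e = enn2real E"
  have "1 \<le> E" using mean_hit_step[OF a(2), of kernel] by (simp add: E_def ht(2)[OF a(1)])
  moreover have "E < \<infinity>" using mean_hit_root_finite[OF a(1)] by (simp add: E_def ht(2)[OF a(1)])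
  ultimately have E: "E = ennreal e" and e: "e > 0"
    by (auto simp: e_def enn2real_positive_iff intro: order.strict_trans2[OF zero_less_one])
  show U: "(\<lambda>\<omega>. hitting_time (X a) r \<omega> / E) \<in> borel_measurable (M a)" by measurable
  show one: "(\<integral>\<^sup>+\<omega>. hitting_time (X a) r \<omega> / E \<partial>M a) = 1"
    using E e by (simp add: nn_integral_divide E_def[symmetric] ennreal_divide_self)
  show "nn_variance (M a) (\<lambda>\<omega>. hitting_time (X a) r \<omega> / E) \<le> ennreal (2 / c) * (K\<^sup>2 / E)"
  proof (cases K)
    case top
    have "K\<^sup>2 / E = top" using e unfolding top E by (simp add: power2_eq_square ennreal_top_divide)
    then show ?thesis using c(1) by (simp add: ennreal_mult_top)
  next
    case (real K')
    note branch = top_branch[OF tree a, folded B_def]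
    have "ennreal (P b (p b)) * mean_hit kernel (p b) b \<le> ennreal K'" if "b \<in> B" for b
    proof -
      have "b \<in> V" using that branch(2) by auto
      then have "ennreal (P b (p b)) * mean_hit kernel (p b) b
          = ennreal (P b (p b)) * (\<integral>\<^sup>+\<omega>. hitting_time (X b) (p b) \<omega> \<partial>M b)"
        by (simp add: ht(2))
      also have "\<dots> \<le> K" unfolding K_def by (rule SUP_upper[OF that])
      finally show ?thesis using real by simp
    qed
    from sq_hit_root_le[OF branch(2) branch(4) branch(3) c \<open>0 \<le> K'\<close> this branch(1)]
    have "sq_hit kernel r a \<le> ennreal (e\<^sup>2 + 2 * K'\<^sup>2 / c * e)"
      by (simp add: e_def E_def ht(2)[OF a(1)])
    have "nn_variance (M a) (\<lambda>\<omega>. hitting_time (X a) r \<omega> / E) + 1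
        = (\<integral>\<^sup>+\<omega>. (hitting_time (X a) r \<omega> / E)\<^sup>2 \<partial>M a)"
      by (rule nn_variance_mean_one[OF prob_space_axioms U one])
    also have "\<dots> = (\<integral>\<^sup>+\<omega>. (hitting_time (X a) r \<omega>)\<^sup>2 * (inverse E)\<^sup>2 \<partial>M a)"
      by (simp add: divide_ennreal_def power_mult_distrib)
    also have "\<dots> = sq_hit kernel r a * (inverse E)\<^sup>2"
      by (simp add: nn_integral_multc ht(3)[OF a(1)])
    also have "\<dots> \<le> ennreal (e\<^sup>2 + 2 * K'\<^sup>2 / c * e) * (inverse E)\<^sup>2"
      by (intro mult_right_mono) (fact, simp)
    also have "\<dots> = ennreal ((e\<^sup>2 + 2 * K'\<^sup>2 / c * e) * (inverse e)\<^sup>2)"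
      using e c(1) unfolding E
      by (simp only: inverse_ennreal ennreal_power inverse_nonnegative_iff_nonnegative less_imp_le)
        (subst ennreal_mult'', auto)
    also have "(e\<^sup>2 + 2 * K'\<^sup>2 / c * e) * (inverse e)\<^sup>2 = 2 / c * (K'\<^sup>2 / e) + 1"
      using e c(1) by (simp add: field_simps power2_eq_square)
    also have "ennreal (2 / c * (K'\<^sup>2 / e) + 1) = ennreal (2 / c) * (K\<^sup>2 / E) + 1"
    proof -
      have "K\<^sup>2 / E = ennreal (K'\<^sup>2 / e)"
        using real e unfolding E by (simp add: ennreal_power divide_ennreal)
      moreover have "ennreal (2 / c * (K'\<^sup>2 / e) + 1) = ennreal (2 / c * (K'\<^sup>2 / e)) + 1"
        using e c(1) by (subst ennreal_plus) auto
      ultimately show ?thesis using c(1) by (simp only: ennreal_mult' zero_le_divide_iff less_imp_le zero_le_numeral simp_thms)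
    qed
    finally show ?thesis
      by (simp add: add.commute[of _ "1 :: ennreal"] ennreal_add_left_cancel_le)
  qed
qed

end

section \<open>Cut-off under strong drift\<close>

theorem proposition2p2:
  fixes v :: "nat \<Rightarrow> 'v"
    and G :: "'v \<Rightarrow> 'v pair_pre_digraph"
    and P :: "'v \<Rightarrow> 'v \<Rightarrow> 'v \<Rightarrow> real"
    and M :: "'v \<Rightarrow> 'v \<Rightarrow> 'w measure"
    and X :: "'v \<Rightarrow> 'v \<Rightarrow> nat \<Rightarrow> 'w \<Rightarrow> 'v"
  assumes "birth_death_family v G P M X"
    and "strong_drift v G P M X"
  shows "(\<lambda>n. nn_variance (M (v n) (v n))
            (\<lambda>\<omega>. hitting_time (X (v n) (v n)) (v 0) \<omega> / mean_hitting_time M X (v n) (v n) (v 0)))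
         \<longlonglongrightarrow> 0
       \<and> cutoff_at_mean_times (\<lambda>n. M (v n) (v n)) (\<lambda>n. hitting_time (X (v n) (v n)) (v 0))"
proof -
  define E where "E n = mean_hitting_time M X (v n) (v n) (v 0)" for n
  define Q where "Q n = (drift_const (v 0) G P M X (v n))\<^sup>2 / E n" for n
  define U where "U n \<omega> = hitting_time (X (v n) (v n)) (v 0) \<omega> / E n" for n \<omega>
  have E_eq: "E n = (\<integral>\<^sup>+\<omega>. hitting_time (X (v n) (v n)) (v 0) \<omega> \<partial>M (v n) (v n))" for n
    by (simp add: E_def mean_hitting_time_def)
  obtain c where c: "c > 0"
    and mu: "\<And>n. n \<ge> 1 \<Longrightarrow> (INF b \<in> branch (G (v n)) (v 0) (top_vertex (G (v n)) (v 0) (v n)).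
        P (v n) b (parent (G (v n)) (v 0) b)) \<ge> c"
    and Q: "Q \<longlonglongrightarrow> 0"
    using assms(2) unfolding strong_drift_def Let_def Q_def E_def by blast
  have bound: "prob_space (M (v n) (v n)) \<and> U n \<in> borel_measurable (M (v n) (v n))
      \<and> (\<integral>\<^sup>+\<omega>. U n \<omega> \<partial>M (v n) (v n)) = 1
      \<and> nn_variance (M (v n) (v n)) (U n) \<le> ennreal (2 / c) * Q n" if n: "n \<ge> 1" for n
  proof -
    have fam: "rooted_tree (G (v n)) (v 0)" "v ` {0..n} \<subseteq> pverts (G (v n))"
        "birth_death (G (v n)) (v 0) (P (v n))"
        "\<And>x. x \<in> pverts (G (v n)) \<Longrightarrow>
          markov_chain_from (M (v n) x) (pverts (G (v n))) (P (v n)) x (X (v n) x)"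
      and "inj v"
      using assms(1) n unfolding birth_death_family_def Let_def by blast+
    interpret birth_death_tree "G (v n)" "v 0" "P (v n)"
      using fam by unfold_locales
    have a: "v n \<in> V" "v n \<noteq> v 0" using fam(2) \<open>inj v\<close> n by (auto simp: inj_eq)
    \<comment> \<open>A real infimum is a lower bound only of a set that is bounded below, here because rates are positive.\<close>
    have "c \<le> P (v n) b (p b)" if b: "b \<in> branch (G (v n)) (v 0) (top_vertex (G (v n)) (v 0) (v n))" for b
    proof -
      have "bdd_below ((\<lambda>b. P (v n) b (p b)) ` branch (G (v n)) (v 0) (top_vertex (G (v n)) (v 0) (v n)))"
        using top_branch(2)[OF tree a] rates_pos(2) by (intro bdd_belowI2[of _ 0] less_imp_le) auto
      from cINF_lower[OF this b] mu[OF n] show ?thesis by simp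
    qed
    note var = hitting_time_variance[OF a fam(4) c this, folded E_eq]
    have "U n = (\<lambda>\<omega>. hitting_time (X (v n) (v n)) (v 0) \<omega> / E n)" by (simp add: U_def fun_eq_iff)
    moreover have "prob_space (M (v n) (v n))"
      using fam(4)[OF a(1)] by (simp add: markov_chain_from_def)
    ultimately show ?thesis
      using var by (simp add: Q_def drift_const_def mean_hitting_time_def)
  qed
  have Q': "(\<lambda>n. ennreal d * Q n) \<longlonglongrightarrow> 0" for d
    using ennreal_tendsto_cmult[OF _ Q, of "ennreal d"] by simp
  have var: "(\<lambda>n. nn_variance (M (v n) (v n)) (U n)) \<longlonglongrightarrow> 0"
    by (rule tendsto_sandwich[OF _ _ tendsto_const Q'])
      (auto intro!: eventually_sequentiallyI[of 1] dest: bound)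
  have "(\<lambda>n. \<P>(\<omega> in M (v n) (v n). \<bar>enn2ereal (U n \<omega>) - ereal 1\<bar> > ereal e)) \<longlonglongrightarrow> 0"
    if e: "e > 0" for e
  proof -
    have "(\<lambda>n. ennreal (1 / e\<^sup>2) * nn_variance (M (v n) (v n)) (U n)) \<longlonglongrightarrow> 0"
      using ennreal_tendsto_cmult[OF _ var, of "ennreal (1 / e\<^sup>2)"] by simp
    then have "(\<lambda>n. ennreal (\<P>(\<omega> in M (v n) (v n). \<bar>enn2ereal (U n \<omega>) - ereal 1\<bar> > ereal e)))
        \<longlonglongrightarrow> ennreal 0"
      unfolding ennreal_0
      by (rule tendsto_sandwich[OF _ _ tendsto_const, rotated 2])
        (auto intro!: eventually_sequentiallyI[of 1] chebyshev_nn_variance e dest: bound)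
    then show ?thesis by (rule tendsto_ennrealD) auto
  qed
  then have "cutoff_at_mean_times (\<lambda>n. M (v n) (v n)) (\<lambda>n. hitting_time (X (v n) (v n)) (v 0))"
    unfolding cutoff_at_mean_times_def converges_in_prob_def E_eq[symmetric] U_def[symmetric] by blast
  with var show ?thesis unfolding U_def[abs_def] E_def by blast
qed

end
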